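(* Let $(\mathfrak{D}_x,\mathfrak{D}_y)$ with $\mathfrak{D}_x = D_x\mathfrak{L}_x$ and $\mathfrak{D}_y = D_y\mathfrak{L}_y$ be a separable pair of delta operators. Let $A=\begin{pmatrix} a_{1,1} & a_{1,2}\\ a_{2,1} & a_{2,2}\end{pmatrix}$ be a real $2\times 2$ matrix and $Z=\{(x_{i,j},y_{i,j})\}_{(i,j)\in\mathbb{N}^2}$ the grid with $(x_{i,j},y_{i,j})^t = A\,(i,j)^t$, i.e. $x_{i,j}=a_{1,1}i+a_{1,2}j$ and $y_{i,j}=a_{2,1}i+a_{2,2}j$. Denote by $(t_{m,n}((x,y);Z))_{(m,n)\in\mathbb{N}^2}$ the delta Abel polynomials associated with $(\mathfrak{D}_x,\mathfrak{D}_y)$ and $Z$, and fix $m,n\in\mathbb{N}$. Then: (i) If $\{p_m\}$ and $\{q_n\}$ are the univariate basic sequences of $\mathfrak{D}_x$ and $\mathfrak{D}_y$, then $$t_{m,n}((x,y);Z)=\begin{vmatrix} x-x_{0,n} & y_{m,0}\\ x_{0,n} & y-y_{m,0}\end{vmatrix}\,\frac{p_m(x-x_{m,n})}{x-x_{m,n}}\cdot\frac{q_n(y-y_{m,n})}{y-y_{m,n}}.$$ (ii) With $\mathfrak{s}_1 = D_x\mathfrak{L}_x\mathfrak{E}_{(a_{1,1},a_{2,1})}$ and $\mathfrak{s}_2 = D_y\mathfrak{L}_y\mathfrak{E}_{(a_{1,2},a_{2,2})}$, $$t_{m,n}((x,y);Z)= J(\mathfrak{s}_1,\mathfrak{s}_2)\,\mathfrak{E}_{(a_{1,1},a_{2,1})}^{-m-1}\mathfrak{E}_{(a_{1,2},a_{2,2})}^{-n-1}\mathfrak{L}_x^{-m-1}\mathfrak{L}_y^{-n-1}(x^my^n),\quad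 J(\mathfrak{s}_1,\mathfrak{s}_2)=\begin{vmatrix} (\mathfrak{s}_1)'_x & (\mathfrak{s}_1)'_y\\ (\mathfrak{s}_2)'_x & (\mathfrak{s}_2)'_y\end{vmatrix}.$$ (iii) $t_{m,n}((x,y);Z)=T_{m,n}(x^my^n)$, where $T_{m,n}$ is the operator $$\begin{vmatrix} (\mathfrak{D}_x)'_x + a_{1,1}\mathfrak{D}_x & a_{2,1}\mathfrak{D}_x\\ a_{1,2}\mathfrak{D}_y & (\mathfrak{D}_y)'_y + a_{2,2}\mathfrak{D}_y\end{vmatrix}\,\mathfrak{E}_{(a_{1,1},a_{2,1})}^{-m}\mathfrak{E}_{(a_{1,2},a_{2,2})}^{-n}\mathfrak{L}_x^{-m-1}\mathfrak{L}_y^{-n-1}.$$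
   Context: Operators act on $\mathbb{R}[x,y]$. $D_x,D_y$ are partial derivatives; $\mathfrak{E}_{(a,b)}$ is the shift $f(x,y)\mapsto f(x+a,y+b)$. A linear operator is shift-invariant if it commutes with all shifts; every shift-invariant operator is a formal power series in $D_x,D_y$ (its indicator). A pair of shift-invariant operators $(\mathfrak{D}_1,\mathfrak{D}_2)$ is a system of delta operators if their indicators have zero constant term and the Jacobian matrix of constant terms of the partial derivatives of the indicators is nonsingular. Its basic sequence $\{p_{\mathbf n}\}$ satisfies $\deg p_{\mathbf n}=|\mathbf n|$, $p_{\mathbf 0}=1$, $p_{\mathbf n}(\mathbf 0)=0$ for $\mathbf n\ne\mathbf 0$, and $\mathfrak{D}_i p_{\mathbf n}=n_i p_{\mathbf n-\mathbf e_i}$. The pair is separable if $\mathfrak{D}_x=D_x\mathfrak{L}_x$, $\mathfrak{D}_y=D_y\mathfrak{L}_y$ with $\mathfrak{L}_x$ (resp. $\mathfrak{L}_y$) an invertible shift-invariant operator whose indicator is a power series in $x$ only (resp. $y$ only). Given a grid $Z=\{z_{\mathbf k}\}$, the delta Gončarov polynomial $t_{\mathbf n}(\mathbf x;Z)$ is the unique polynomial in the span of $\{p_{\mathbf k}:\mathbf k\le\mathbf n\}$ with $[\mathfrak{D}_1^{k_1}\mathfrak{D}_2^{k_2}t_{\mathbf n}](z_{\mathbf k})=\mathbf n!\,\delta_{\mathbf k,\mathbf n}$ for all $\mathbf k\le\mathbf n$; delta Abel polynomials are those with grid $z_{\mathbf k}=A\mathbf k$. For a shift-invariant $\mathfrak{L}$,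 the Pincherle derivatives are $\mathfrak{L}'_x(p)=\mathfrak{L}(xp)-x\mathfrak{L}(p)$ and $\mathfrak{L}'_y(p)=\mathfrak{L}(yp)-y\mathfrak{L}(p)$. *)

theory Defs
  imports "HOL-Analysis.Analysis" "HOL-Computational_Algebra.Polynomial_Factorial"
begin

text \<open>
  The ring of real polynomials in \<open>x\<close> and \<open>y\<close> is \<open>\<real>[x][y]\<close>: the outer variable of a
  \<^typ>\<open>real poly poly\<close> is \<open>y\<close>, and its coefficients are polynomials in \<open>x\<close>.
  Bivariate power series use the same nesting.
\<close>

type_synonym bpoly = "real poly poly"

definition const2 :: "real \<Rightarrow> bpoly"
  where "const2 c = [:[:c:]:]"

definition varX :: bpoly
  where "varX = [:[:0, 1:]:]"

definition varY :: bpoly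
  where "varY = [:0, 1:]"

definition embed_x :: "real poly \<Rightarrow> bpoly"
  where "embed_x p = [:p:]"

definition embed_y :: "real poly \<Rightarrow> bpoly"
  where "embed_y q = map_poly (\<lambda>c. [:c:]) q"

definition eval2 :: "bpoly \<Rightarrow> real^2 \<Rightarrow> real"
  where "eval2 f z = poly (poly f [:z $ 2:]) (z $ 1)"

definition scale2 :: "real \<Rightarrow> bpoly \<Rightarrow> bpoly"
  where "scale2 c f = smult [:c:] f"

lemma vector_space_scale2: "vector_space scale2"
  by unfold_locales
    (simp_all add: scale2_def smult_add_right mult.commute flip: smult_add_left one_pCons)

definition total_degree :: "bpoly \<Rightarrow> nat"
  where "total_degree f = Max (insert 0 {i + j |i j. coeff (coeff f j) i \<noteq> 0})"

section \<open>Operators\<close>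

type_synonym op2 = "bpoly \<Rightarrow> bpoly"

definition Dx :: op2
  where "Dx = map_poly pderiv"

definition Dy :: op2
  where "Dy = pderiv"

definition shift :: "real \<Rightarrow> real \<Rightarrow> op2"
  where "shift a b f = pcompose (map_poly (\<lambda>c. pcompose c [:a, 1:]) f) [:[:b:], 1:]"

lemma eval2_shift: "eval2 (shift a b f) z = eval2 f (z + vector [a, b])"
proof -
  have *: "poly (map_poly (\<lambda>c. pcompose c [:a, 1:]) f) [:v:]
      = pcompose (poly f [:v:]) [:a, 1:]" for v
    by (induction f) (simp_all add: map_poly_pCons pcompose_add pcompose_mult pcompose_pCons pcompose_smult)
  have "poly [:[:b:], 1:] [:z $ 2:] = [:z $ 2 + b:]"
    by simp
  then show ?thesis
    by (simp add: eval2_def shift_def poly_pcompose * vector_2 add.commute)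
qed

definition shift_invariant :: "op2 \<Rightarrow> bool"
  where "shift_invariant Q \<longleftrightarrow>
    Vector_Spaces.linear scale2 scale2 Q \<and> (\<forall>a b. Q \<circ> shift a b = shift a b \<circ> Q)"

text \<open>
  The operator \<open>\<Sum>\<^sub>i\<^sub>,\<^sub>j F\<^sub>i\<^sub>j D\<^sub>x\<^sup>i D\<^sub>y\<^sup>j\<close>, where \<open>F\<^sub>i\<^sub>j\<close> is the coefficient of \<open>x\<^sup>i y\<^sup>j\<close>.
  On a given polynomial all terms with \<open>i\<close> or \<open>j\<close> above the total degree vanish.
\<close>

definition series_op :: "real fps fps \<Rightarrow> op2"
  where "series_op F f = (\<Sum>i\<le>total_degree f. \<Sum>j\<le>total_degree f.
    scale2 (fps_nth (fps_nth F j) i) ((Dx ^^ i) ((Dy ^^ j) f)))"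

definition has_indicator :: "op2 \<Rightarrow> real fps fps \<Rightarrow> bool"
  where "has_indicator Q F \<longleftrightarrow> Q = series_op F"

definition const_term :: "real fps fps \<Rightarrow> real"
  where "const_term F = fps_nth (fps_nth F 0) 0"

definition fps_deriv_x :: "real fps fps \<Rightarrow> real fps fps"
  where "fps_deriv_x F = Abs_fps (\<lambda>j. fps_deriv (fps_nth F j))"

definition fps_deriv_y :: "real fps fps \<Rightarrow> real fps fps"
  where "fps_deriv_y F = fps_deriv F"

definition series_in_x :: "real fps fps \<Rightarrow> bool"
  where "series_in_x F \<longleftrightarrow> (\<exists>f. F = fps_const f)"

definition series_in_y :: "real fps fps \<Rightarrow> bool"
  where "series_in_y F \<longleftrightarrow> (\<exists>g. F = Abs_fps (\<lambda>j. fps_const (fps_nth g j)))"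

section \<open>Delta operators and basic sequences\<close>

definition delta_system :: "op2 \<Rightarrow> op2 \<Rightarrow> bool"
  where "delta_system D1 D2 \<longleftrightarrow>
    shift_invariant D1 \<and> shift_invariant D2 \<and>
    (\<exists>F1 F2. has_indicator D1 F1 \<and> has_indicator D2 F2 \<and>
      const_term F1 = 0 \<and> const_term F2 = 0 \<and>
      det (vector [vector [const_term (fps_deriv_x F1), const_term (fps_deriv_y F1)],
                   vector [const_term (fps_deriv_x F2), const_term (fps_deriv_y F2)]]
           :: real^2^2) \<noteq> 0)"

definition separable_pair :: "op2 \<Rightarrow> op2 \<Rightarrow> op2 \<Rightarrow> op2 \<Rightarrow> bool"
  where "separable_pair D1 D2 L1 L2 \<longleftrightarrow>
    delta_system D1 D2 \<and>
    D1 = Dx \<circ> L1 \<and> D2 = Dy \<circ> L2 \<and>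
    shift_invariant L1 \<and> bij L1 \<and> (\<exists>F. has_indicator L1 F \<and> series_in_x F) \<and>
    shift_invariant L2 \<and> bij L2 \<and> (\<exists>F. has_indicator L2 F \<and> series_in_y F)"

text \<open>In the recurrences below, an index \<open>0 - 1\<close> only occurs with the factor \<open>0\<close>.\<close>

definition is_basic_sequence :: "op2 \<Rightarrow> op2 \<Rightarrow> (nat \<Rightarrow> nat \<Rightarrow> bpoly) \<Rightarrow> bool"
  where "is_basic_sequence D1 D2 p \<longleftrightarrow>
    p 0 0 = 1 \<and>
    (\<forall>m n. total_degree (p m n) = m + n) \<and>
    (\<forall>m n. (m, n) \<noteq> (0, 0) \<longrightarrow> eval2 (p m n) 0 = 0) \<and>
    (\<forall>m n. D1 (p m n) = scale2 (real m) (p (m - 1) n)) \<and>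
    (\<forall>m n. D2 (p m n) = scale2 (real n) (p m (n - 1)))"

definition basic_sequence :: "op2 \<Rightarrow> op2 \<Rightarrow> nat \<Rightarrow> nat \<Rightarrow> bpoly"
  where "basic_sequence D1 D2 = (THE p. is_basic_sequence D1 D2 p)"

text \<open>
  The univariate basic sequence of an operator that restricts to one of the subrings \<open>\<real>[x]\<close>
  and \<open>\<real>[y]\<close>; \<open>\<iota>\<close> is the corresponding embedding, \<^const>\<open>embed_x\<close> or \<^const>\<open>embed_y\<close>.
\<close>

definition is_univariate_basic_sequence ::
    "(real poly \<Rightarrow> bpoly) \<Rightarrow> op2 \<Rightarrow> (nat \<Rightarrow> real poly) \<Rightarrow> bool"
  where "is_univariate_basic_sequence \<iota> D p \<longleftrightarrow>
    p 0 = 1 \<and>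
    (\<forall>n. degree (p n) = n) \<and>
    (\<forall>n. n \<noteq> 0 \<longrightarrow> poly (p n) 0 = 0) \<and>
    (\<forall>n. D (\<iota> (p n)) = scale2 (real n) (\<iota> (p (n - 1))))"

section \<open>Delta Goncarov and delta Abel polynomials\<close>

definition is_goncarov ::
    "op2 \<Rightarrow> op2 \<Rightarrow> (nat \<Rightarrow> nat \<Rightarrow> real^2) \<Rightarrow> nat \<Rightarrow> nat \<Rightarrow> bpoly \<Rightarrow> bool"
  where "is_goncarov D1 D2 Z m n t \<longleftrightarrow>
    t \<in> module.span scale2 {basic_sequence D1 D2 i j |i j. i \<le> m \<and> j \<le> n} \<and>
    (\<forall>i\<le>m. \<forall>j\<le>n. eval2 ((D1 ^^ i) ((D2 ^^ j) t)) (Z i j)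
       = (if i = m \<and> j = n then fact m * fact n else 0))"

definition goncarov ::
    "op2 \<Rightarrow> op2 \<Rightarrow> (nat \<Rightarrow> nat \<Rightarrow> real^2) \<Rightarrow> nat \<Rightarrow> nat \<Rightarrow> bpoly"
  where "goncarov D1 D2 Z m n = (THE t. is_goncarov D1 D2 Z m n t)"

definition linear_grid :: "real^2^2 \<Rightarrow> nat \<Rightarrow> nat \<Rightarrow> real^2"
  where "linear_grid A i j = A *v vector [real i, real j]"

definition delta_abel :: "op2 \<Rightarrow> op2 \<Rightarrow> real^2^2 \<Rightarrow> nat \<Rightarrow> nat \<Rightarrow> bpoly"
  where "delta_abel D1 D2 A = goncarov D1 D2 (linear_grid A)"

section \<open>Pincherle derivatives and determinants of operators\<close>

definition pincherle_x :: "op2 \<Rightarrow> op2"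
  where "pincherle_x Q f = Q (varX * f) - varX * Q f"

definition pincherle_y :: "op2 \<Rightarrow> op2"
  where "pincherle_y Q f = Q (varY * f) - varY * Q f"

text \<open>
  Determinant of the matrix with rows \<open>(a, b)\<close> and \<open>(c, d)\<close>, whose entries are operators
  multiplied by composition. It is only used with shift-invariant entries, which commute.
\<close>

definition op_det :: "op2 \<Rightarrow> op2 \<Rightarrow> op2 \<Rightarrow> op2 \<Rightarrow> op2"
  where "op_det a b c d f = a (d f) - b (c f)"

definition op_jacobian :: "op2 \<Rightarrow> op2 \<Rightarrow> op2"
  where "op_jacobian s1 s2 =
    op_det (pincherle_x s1) (pincherle_y s1) (pincherle_x s2) (pincherle_y s2)"

end

theory Submission
  imports Defs
begin

text \<open>
  Put \<open>P\<^sub>k = L\<^sub>x\<^sup>-\<^sup>k\<^sup>-\<^sup>1 x\<^sup>k\<close> and let \<open>p\<^sub>k\<close> be the Pincherle derivative of \<open>D\<^sub>x L\<^sub>x\<close> applied to \<open>P\<^sub>k\<close>.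
  Then \<open>(p\<^sub>k)\<close> is the basic sequence, \<open>D\<^sub>x L\<^sub>x P\<^sub>k = k P\<^sub>k\<^sub>-\<^sub>1\<close> and \<open>p\<^sub>k = x P\<^sub>k\<^sub>-\<^sub>1\<close> for \<open>k > 0\<close>;
  write \<open>Q\<^sub>l\<close>, \<open>q\<^sub>l\<close> for the analogues in \<open>y\<close>. The operator determinant sends \<open>P\<^sub>k Q\<^sub>l\<close> to
  \<open>((x + a\<^sub>1\<^sub>1 k)(y + a\<^sub>2\<^sub>2 l) - a\<^sub>1\<^sub>2 a\<^sub>2\<^sub>1 k l) P\<^sub>k\<^sub>-\<^sub>1 Q\<^sub>l\<^sub>-\<^sub>1\<close>, which vanishes at
  \<open>- A (k, l)\<close> unless \<open>k = l = 0\<close>. It commutes with the delta operators and with shifts, so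
  shifting its value at \<open>P\<^sub>m Q\<^sub>n\<close> by \<open>- A (m, n)\<close> gives a solution of the interpolation
  problem, and all three formulas describe this polynomial.
\<close>

section \<open>Linear operators on bivariate polynomials and their commutation\<close>

interpretation scale2: vector_space scale2
  by (rule vector_space_scale2)

abbreviation linear2 :: "op2 \<Rightarrow> bool"
  where "linear2 \<equiv> Vector_Spaces.linear scale2 scale2"

lemma linear2_iff:
  "linear2 Q \<longleftrightarrow> (\<forall>f g. Q (f + g) = Q f + Q g) \<and> (\<forall>c f. Q (scale2 c f) = scale2 c (Q f))"
  using vector_space_scale2 by (simp add: Vector_Spaces.linear_iff)

lemma linear2_add: "linear2 Q \<Longrightarrow> Q (f + g) = Q f + Q g"
  and linear2_scale: "linear2 Q \<Longrightarrow> Q (scale2 c f) = scale2 c (Q f)"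
  by (simp_all add: linear2_iff)

lemma linear2_0: "linear2 Q \<Longrightarrow> Q 0 = 0"
  using linear2_add[of Q 0 0] by simp

lemma linear2_diff: "linear2 Q \<Longrightarrow> Q (f - g) = Q f - Q g"
  using linear2_add[of Q "f - g" g] by simp

lemma linear2_sum: "linear2 Q \<Longrightarrow> Q (sum f A) = (\<Sum>a\<in>A. Q (f a))"
  by (induction A rule: infinite_finite_induct) (simp_all add: linear2_0 linear2_add)

lemma linear2_compose: "linear2 Q \<Longrightarrow> linear2 R \<Longrightarrow> linear2 (\<lambda>f. Q (R f))"
  by (simp add: linear2_iff)

lemma linear2_funpow: "linear2 Q \<Longrightarrow> linear2 (Q ^^ n)"
  by (induction n) (simp_all add: linear2_iff)

lemma funpow_eq_0_mono:
  assumes "linear2 Q" "(Q ^^ j) f = 0" "j \<le> i"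
  shows "(Q ^^ i) f = 0"
proof -
  have "(Q ^^ i) f = (Q ^^ (i - j)) ((Q ^^ j) f)"
    using assms(3) by (metis funpow_add comp_apply le_add_diff_inverse2)
  then show ?thesis
    using assms(1,2) by (simp add: linear2_0[OF linear2_funpow])
qed

lemma scale2_eq: "scale2 c f = const2 c * f"
  by (simp add: scale2_def const2_def)

lemma const2_simps [simp]:
  "const2 0 = 0" "const2 1 = 1"
  "const2 (a + b) = const2 a + const2 b" "const2 (a * b) = const2 a * const2 b"
  "const2 (- a) = - const2 a" "const2 (a - b) = const2 a - const2 b"
  by (simp_all add: const2_def one_pCons)

lemma const2_of_nat [simp]: "const2 (real n) = of_nat n"
  by (induction n) simp_all

lemma linear2_mult: "linear2 (\<lambda>f. g * f)"
  by (simp add: linear2_iff scale2_eq algebra_simps)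

lemma linear2_const2_mult: "linear2 Q \<Longrightarrow> Q (const2 c * f) = const2 c * Q f"
  using linear2_scale[of Q c f] by (simp add: scale2_eq)

lemma linear2_of_nat_mult: "linear2 Q \<Longrightarrow> Q (of_nat k * f) = of_nat k * Q f"
  using linear2_const2_mult[of Q "real k" f] by simp

lemma funpow_commute: "(\<And>f. Q (R f) = R (Q f)) \<Longrightarrow> Q ((R ^^ n) f) = (R ^^ n) (Q f)"
  by (induction n) simp_all

lemma funpow_funpow_commute:
  assumes "\<And>f. Q (R f) = R (Q f)"
  shows "(Q ^^ m) ((R ^^ n) f) = (R ^^ n) ((Q ^^ m) f)"
  by (induction m) (simp_all add: funpow_commute[of Q R, OF assms])

lemma inv_commute:
  assumes "bij L" "\<And>f. Q (L f) = L (Q f)"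
  shows "Q (inv L f) = inv L (Q f)"
proof -
  have "inv L (Q (L (inv L f))) = Q (inv L f)"
    unfolding assms(2) using assms(1) by (simp add: bij_is_inj)
  then show ?thesis
    using assms(1) by (simp add: bij_is_surj surj_f_inv_f)
qed

section \<open>Evaluation, shifts and derivatives\<close>

lemma eval2_simps [simp]:
  "eval2 0 z = 0" "eval2 1 z = 1"
  "eval2 (f + g) z = eval2 f z + eval2 g z" "eval2 (f - g) z = eval2 f z - eval2 g z"
  "eval2 (- f) z = - eval2 f z"
  "eval2 (f * g) z = eval2 f z * eval2 g z"
  "eval2 (const2 c) z = c" "eval2 varX z = z $ 1" "eval2 varY z = z $ 2"
  by (simp_all add: eval2_def const2_def varX_def varY_def)

lemma eval2_of_nat [simp]: "eval2 (of_nat k) z = real k"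
  by (induction k) simp_all

text \<open>Over the integral domain \<open>real poly\<close> a nonzero polynomial has finitely many
  roots, whereas agreement at all points makes every constant \<open>[:v:]\<close> a root of
  \<open>f - g\<close>.\<close>

lemma eval2_eqI:
  assumes "\<And>z. eval2 f z = eval2 g z"
  shows "f = g"
proof (rule ccontr)
  assume "f \<noteq> g"
  then have fin: "finite {x. poly (f - g) x = 0}"
    by (intro poly_roots_finite) simp
  have "poly (poly (f - g) [:v:]) u = 0" for u v
    using assms[of "vector [u, v]"] by (simp add: eval2_def vector_2)
  then have "poly (f - g) [:v:] = 0" for v
    using poly_all_0_iff_0 by blast
  then have "range (\<lambda>v::real. [:v:]) \<subseteq> {x. poly (f - g) x = 0}"
    by auto
  then have "finite (range (\<lambda>v::real. [:v:]))"
    using fin finite_subset by blast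
  moreover have "inj (\<lambda>v::real. [:v:])"
    by (simp add: inj_on_def)
  ultimately show False
    using finite_imageD infinite_UNIV_char_0 by blast
qed

lemma shift_simps:
  "shift a b 1 = 1"
  "shift a b (f + g) = shift a b f + shift a b g"
  "shift a b (f - g) = shift a b f - shift a b g"
  "shift a b (f * g) = shift a b f * shift a b g"
  "shift a b (const2 c) = const2 c"
  "shift a b varX = varX + const2 a" "shift a b varY = varY + const2 b"
  by (rule eval2_eqI; simp add: eval2_shift vector_2)+

lemma shift_of_nat: "shift a b (of_nat k) = of_nat k"
  using shift_simps(5)[of a b "real k"] by simp

lemma linear2_shift: "linear2 (shift a b)"
  by (simp add: linear2_iff scale2_eq shift_simps)

lemma shift_shift: "shift a b (shift c d f) = shift (a + c) (b + d) f"
proof (rule eval2_eqI)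
  fix z :: "real^2"
  have "z + vector [a, b] + vector [c, d] = z + (vector [a + c, b + d] :: real^2)"
    by (simp add: vec_eq_iff forall_2)
  then show "eval2 (shift a b (shift c d f)) z = eval2 (shift (a + c) (b + d) f) z"
    by (simp only: eval2_shift)
qed

lemma shift_0_0: "shift 0 0 = id"
proof
  have "(vector [0, 0] :: real^2) = 0"
    by (simp add: vec_eq_iff forall_2 vector_2)
  then show "shift 0 0 f = id f" for f
    by (auto intro: eval2_eqI simp: eval2_shift)
qed

lemma funpow_shift: "shift a b ^^ k = shift (real k * a) (real k * b)"
  by (induction k) (auto simp: shift_0_0 shift_shift algebra_simps)

lemma inv_shift: "inv (shift a b) = shift (- a) (- b)"
  by (rule inv_equality) (simp_all add: shift_shift shift_0_0)

section \<open>Coefficients and product rules of the partial derivatives\<close>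

lemma coeff_coeff_Dx: "coeff (coeff (Dx f) j) i = of_nat (Suc i) * coeff (coeff f j) (Suc i)"
  by (simp add: Dx_def coeff_map_poly coeff_pderiv)

lemma coeff_coeff_Dy: "coeff (coeff (Dy f) j) i = of_nat (Suc j) * coeff (coeff f (Suc j)) i"
  by (simp add: Dy_def coeff_pderiv of_nat_poly algebra_simps)

lemma bpoly_eqI: "(\<And>i j. coeff (coeff f j) i = coeff (coeff g j) i) \<Longrightarrow> f = (g :: bpoly)"
  by (simp add: poly_eq_iff)

lemma Dx_add: "Dx (f + g) = Dx f + Dx g"
  by (rule bpoly_eqI) (simp add: coeff_coeff_Dx algebra_simps)

lemma Dx_pCons: "Dx (pCons a f) = pCons (pderiv a) (Dx f)"
  by (simp add: Dx_def map_poly_pCons)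

lemma Dx_smult: "Dx (smult a f) = smult (pderiv a) f + smult a (Dx f)"
  by (rule poly_eqI) (simp add: Dx_def coeff_map_poly pderiv_mult)

lemma Dx_mult: "Dx (f * g) = Dx f * g + f * Dx g"
proof (induction f)
  case 0
  then show ?case by (simp add: Dx_def)
next
  case (pCons a f)
  then show ?case by (simp add: Dx_add Dx_smult Dx_pCons algebra_simps)
qed

lemma Dy_add: "Dy (f + g) = Dy f + Dy g"
  by (simp add: Dy_def pderiv_add)

lemma Dy_mult: "Dy (f * g) = Dy f * g + f * Dy g"
  by (simp add: Dy_def pderiv_mult)

lemma Dx_const2 [simp]: "Dx (const2 c) = 0"
  and Dy_const2 [simp]: "Dy (const2 c) = 0"
  by (simp_all add: Dx_pCons const2_def Dy_def) (simp add: Dx_def)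

lemma Dx_vars [simp]: "Dx varX = 1" "Dx varY = 0"
  by (simp_all add: varX_def varY_def Dx_def map_poly_pCons pderiv_pCons one_pCons)

lemma Dy_vars [simp]: "Dy varX = 0" "Dy varY = 1"
  by (simp_all add: varX_def varY_def Dy_def pderiv_pCons one_pCons)

lemma linear2_Dx: "linear2 Dx"
  by (simp add: linear2_iff scale2_eq Dx_add Dx_mult)

lemma linear2_Dy: "linear2 Dy"
  by (simp add: linear2_iff scale2_eq Dy_add Dy_mult)

lemma Dx_Dy: "Dx (Dy f) = Dy (Dx f)"
  by (rule bpoly_eqI) (simp add: coeff_coeff_Dx coeff_coeff_Dy)

lemma eval2_sum: "eval2 (sum f A) z = (\<Sum>a\<in>A. eval2 (f a) z)"
  by (induction A rule: infinite_finite_induct) simp_all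

lemma eval2_embed_y: "eval2 (embed_y q) z = poly q (z $ 2)"
  by (induction q) (simp_all add: eval2_def embed_y_def map_poly_pCons)

text \<open>The parameter \<open>b\<close> is free because a polynomial in \<open>x\<close> alone is
  unaffected by shifts of \<open>y\<close>; a common shift vector can thus serve both
  variables.\<close>

lemma embed_x_pcompose: "embed_x (pcompose p [:a, 1:]) = shift a b (embed_x p)"
  by (rule eval2_eqI) (simp add: eval2_shift, simp add: eval2_def embed_x_def poly_pcompose add.commute)

lemma embed_y_pcompose: "embed_y (pcompose q [:b, 1:]) = shift a b (embed_y q)"
  by (rule eval2_eqI) (simp add: eval2_shift eval2_embed_y poly_pcompose add.commute)

lemma bpoly_induct [case_names const add varX varY]:
  assumes "\<And>r. Q (const2 r)" "\<And>f g. Q f \<Longrightarrow> Q g \<Longrightarrow> Q (f + g)"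
    and "\<And>f. Q f \<Longrightarrow> Q (varX * f)" "\<And>f. Q f \<Longrightarrow> Q (varY * f)"
  shows "Q f"
proof (induction f)
  case 0
  show ?case using assms(1)[of 0] by simp
next
  case (pCons p f)
  have "Q [:p:]"
  proof (induction p)
    case 0
    show ?case using assms(1)[of 0] by simp
  next
    case (pCons r p)
    have "[:pCons r p:] = const2 r + varX * [:p:]"
      by (simp add: const2_def varX_def)
    then show ?case
      using assms pCons by metis
  qed
  moreover have "pCons p f = [:p:] + varY * f"
    by (simp add: varY_def)
  ultimately show ?case
    using assms pCons by metis
qed

lemma Dx_shift: "Dx (shift a b f) = shift a b (Dx f)"
  by (induction f rule: bpoly_induct)
    (simp_all add: shift_simps Dx_add Dx_mult linear2_0[OF linear2_shift])

lemma Dy_shift: "Dy (shift a b f) = shift a b (Dy f)"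
  by (induction f rule: bpoly_induct)
    (simp_all add: shift_simps Dy_add Dy_mult linear2_0[OF linear2_shift])

lemma Dx_Dy_zero_imp_const2:
  assumes "Dx g = 0" "Dy g = 0"
  shows "g = const2 (coeff (coeff g 0) 0)"
proof (rule bpoly_eqI)
  fix i j
  show "coeff (coeff g j) i = coeff (coeff (const2 (coeff (coeff g 0) 0)) j) i"
    using coeff_coeff_Dx[of g 0 "i - 1"] coeff_coeff_Dx[of g j "i - 1"] coeff_coeff_Dy[of g "j - 1" i] assms
    by (cases i; cases j) (simp_all add: const2_def)
qed

text \<open>The factor is the product of \<open>i + 1\<close> up to \<open>i + k\<close>. It stays
  existential because later arguments rely just on its being nonzero and independent of
  \<open>f\<close> and \<open>j\<close>.\<close>

lemma coeff_funpow_Dx: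
  "\<exists>r. r \<noteq> 0 \<and> (\<forall>f j. coeff (coeff ((Dx ^^ k) f) j) i = r * coeff (coeff f j) (i + k))"
proof (induction k arbitrary: i)
  case 0
  show ?case by (rule exI[of _ 1]) simp
next
  case (Suc k)
  obtain r where "r \<noteq> 0" "\<And>f j. coeff (coeff ((Dx ^^ k) f) j) (Suc i) = r * coeff (coeff f j) (Suc i + k)"
    using Suc by blast
  then show ?case
    by (intro exI[of _ "of_nat (Suc i) * r"]) (simp add: coeff_coeff_Dx del: of_nat_Suc)
qed

lemma coeff_funpow_Dy:
  "\<exists>r. r \<noteq> 0 \<and> (\<forall>f i. coeff (coeff ((Dy ^^ k) f) j) i = r * coeff (coeff f (j + k)) i)"
proof (induction k arbitrary: j)
  case 0
  show ?case by (rule exI[of _ 1]) simp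
next
  case (Suc k)
  obtain r where "r \<noteq> 0" "\<And>f i. coeff (coeff ((Dy ^^ k) f) (Suc j)) i = r * coeff (coeff f (Suc j + k)) i"
    using Suc by blast
  then show ?case
    by (intro exI[of _ "of_nat (Suc j) * r"]) (simp add: coeff_coeff_Dy del: of_nat_Suc)
qed

text \<open>Ensures that the \<open>Max\<close> in \<open>total_degree\<close> is taken over a
  finite set.\<close>

lemma finite_exponent_sums: "finite {i + j |i j. coeff (coeff (f :: bpoly) j) i \<noteq> 0}"
proof -
  define N where "N = (\<Sum>j\<le>degree f. degree (coeff f j))"
  have "i \<le> N \<and> j \<le> degree f" if "coeff (coeff f j) i \<noteq> 0" for i j
  proof -
    have j: "j \<le> degree f"
      using that by (metis coeff_0 le_degree)
    have "i \<le> degree (coeff f j)"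
      using that by (rule le_degree)
    also have "\<dots> \<le> N"
      unfolding N_def by (rule member_le_sum) (use j in auto)
    finally show ?thesis using j by simp
  qed
  then have "{i + j |i j. coeff (coeff f j) i \<noteq> 0} \<subseteq> {..N + degree f}"
    by (auto intro: add_mono)
  then show ?thesis
    using finite_subset by blast
qed

lemma coeff_eq_0_total_degree:
  assumes "total_degree f < i + j"
  shows "coeff (coeff f j) i = 0"
proof (rule ccontr)
  assume "coeff (coeff f j) i \<noteq> 0"
  then have "i + j \<le> total_degree f"
    unfolding total_degree_def by (intro Max_ge) (auto simp: finite_exponent_sums)
  with assms show False by simp
qed

lemma total_degree_eqI:
  assumes "\<And>i j. coeff (coeff f j) i \<noteq> 0 \<Longrightarrow> i \<le> m \<and> j \<le> n"
    and "coeff (coeff f n) m \<noteq> 0"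
  shows "total_degree f = m + n"
  unfolding total_degree_def
  by (rule Max_eqI) (use assms in \<open>auto simp: finite_exponent_sums intro: add_mono\<close>)

lemma funpow_Dx_eq_0: "total_degree f < k \<Longrightarrow> (Dx ^^ k) f = 0"
proof (rule bpoly_eqI)
  fix i j assume "total_degree f < k"
  then show "coeff (coeff ((Dx ^^ k) f) j) i = coeff (coeff 0 j) i"
    using coeff_funpow_Dx[of k i] coeff_eq_0_total_degree[of f "i + k" j] by force
qed

lemma funpow_Dy_eq_0: "total_degree f < k \<Longrightarrow> (Dy ^^ k) f = 0"
proof (rule bpoly_eqI)
  fix i j assume "total_degree f < k"
  then show "coeff (coeff ((Dy ^^ k) f) j) i = coeff (coeff 0 j) i"
    using coeff_funpow_Dy[of k j] coeff_eq_0_total_degree[of f i "j + k"] by force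
qed

section \<open>Delta operators in one of the two variables\<close>

text \<open>The product is a falling factorial in truncated subtraction. Once \<open>i > k\<close>
  it contains a zero factor, so the truncated index \<open>k - i\<close> is harmless.\<close>

lemma funpow_lowering:
  assumes "linear2 Q" "\<And>k. Q (p k) = of_nat k * p (k - 1)"
  shows "(Q ^^ i) (p k) = of_nat (\<Prod>j<i. k - j) * p (k - i)"
proof (induction i)
  case 0
  show ?case by simp
next
  case (Suc i)
  have "(Q ^^ Suc i) (p k) = of_nat (\<Prod>j<i. k - j) * Q (p (k - i))"
    by (simp add: Suc linear2_of_nat_mult[OF assms(1)] del: of_nat_prod)
  then show ?case
    by (simp add: assms(2) mult_ac)
qed

lemma linear2_pincherle: "linear2 Q \<Longrightarrow> linear2 (\<lambda>f. Q (v * f) - v * Q f)"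
proof -
  assume Q: "linear2 Q"
  have "Q (v * (const2 r * f)) - v * Q (const2 r * f) = const2 r * (Q (v * f) - v * Q f)" for r f
    by (simp add: mult.left_commute[of v] linear2_const2_mult[OF Q] right_diff_distrib)
  moreover have "Q (v * (f + g)) - v * Q (f + g) = (Q (v * f) - v * Q f) + (Q (v * g) - v * Q g)" for f g
    by (simp add: linear2_add[OF Q] distrib_left)
  ultimately show ?thesis
    by (simp add: linear2_iff scale2_eq)
qed

text \<open>One variable in isolation: \<open>d\<close> is the derivative in \<open>v\<close>, and
  \<open>L\<close> a power series in \<open>d\<close> with coefficients \<open>c\<close>. Stating
  the series for all large truncation bounds lets two arguments of \<open>L\<close> share one
  bound.\<close>

locale delta_axis =
  fixes d L :: op2 and v :: bpoly and c :: "nat \<Rightarrow> real"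
  assumes linear_d: "linear2 d"
    and d_mult: "d (f * g) = d f * g + f * d g"
    and d_v: "d v = 1"
    and bij_L: "bij L"
    and linear_L: "linear2 L"
    and L_series: "\<forall>\<^sub>F N in sequentially. L f = (\<Sum>i\<le>N. scale2 (c i) ((d ^^ i) f))"
begin

definition D :: op2
  where "D = d \<circ> L"

definition pin :: op2
  where "pin f = D (v * f) - v * D f"

text \<open>A Sheffer-type sequence: it obeys the lowering rule of the basic sequence
  (\<open>D_P\<close>) without its normalisation at the origin.\<close>

definition P :: "nat \<Rightarrow> bpoly"
  where "P k = (inv L ^^ (k + 1)) (v ^ k)"

text \<open>The transfer formula of the finite operator calculus, taken as the definition of the
  basic sequence.\<close>

definition B :: "nat \<Rightarrow> bpoly"
  where "B k = pin (P k)"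

text \<open>A linear operator commuting with \<open>d\<close> passes through every truncated series.
  The commutation rules for \<open>inv L\<close> and \<open>D\<close> all derive from this.\<close>

lemma commute_L:
  assumes Q: "linear2 Q" "\<And>f. Q (d f) = d (Q f)"
  shows "Q (L f) = L (Q f)"
proof -
  obtain N where "L f = (\<Sum>i\<le>N. scale2 (c i) ((d ^^ i) f))"
    "L (Q f) = (\<Sum>i\<le>N. scale2 (c i) ((d ^^ i) (Q f)))"
    using eventually_happens[OF eventually_conj[OF L_series[of f] L_series[of "Q f"]]] by auto
  then show ?thesis
    by (simp add: linear2_sum[OF Q(1)] linear2_scale[OF Q(1)] funpow_commute[of Q d, OF Q(2)])
qed

lemma L_inv [simp]: "L (inv L f) = f" and inv_L [simp]: "inv L (L f) = f"
  using bij_L by (simp_all add: bij_is_surj surj_f_inv_f bij_is_inj)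

lemma L_eq_0_iff: "L f = 0 \<longleftrightarrow> f = 0"
  using linear2_0[OF linear_L] inv_L by metis

lemma linear_inv_L: "linear2 (inv L)"
  unfolding linear2_iff
proof (intro conjI allI)
  fix f g r
  have "inv L (L (inv L f + inv L g)) = inv L (f + g)"
    unfolding linear2_add[OF linear_L] by simp
  then show "inv L (f + g) = inv L f + inv L g" by simp
  have "inv L (L (scale2 r (inv L f))) = inv L (scale2 r f)"
    unfolding linear2_scale[OF linear_L] by simp
  then show "inv L (scale2 r f) = scale2 r (inv L f)" by simp
qed

lemma commute_inv_L:
  assumes "linear2 Q" "\<And>f. Q (d f) = d (Q f)"
  shows "Q (inv L f) = inv L (Q f)"
  using bij_L commute_L[OF assms] by (rule inv_commute)

lemma commute_D:
  assumes "linear2 Q" "\<And>f. Q (d f) = d (Q f)"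
  shows "Q (D f) = D (Q f)"
  using assms by (simp add: D_def commute_L)

lemma linear_D: "linear2 D"
  using linear2_compose[OF linear_d linear_L] by (simp add: D_def comp_def)

lemma d_L: "d (L f) = L (d f)"
  by (rule commute_L[OF linear_d refl])

lemma d_D: "d (D f) = D (d f)"
  by (rule commute_D[OF linear_d refl])

lemma linear_pin: "linear2 pin"
  using linear2_pincherle[OF linear_D] by (simp add: pin_def[abs_def])

text \<open>In commutator language this is the Jacobi identity: \<open>D\<close> commutes with
  \<open>d\<close>, and the commutator of \<open>d\<close> with multiplication by \<open>v\<close>
  is the identity.\<close>

lemma pin_d: "pin (d f) = d (pin f)"
proof -
  have "d (pin f) = D (d (v * f)) - D f - v * D (d f)"
    by (simp add: pin_def linear2_diff[OF linear_d] d_mult d_v d_D algebra_simps)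
  also have "d (v * f) = f + v * d f"
    by (simp add: d_mult d_v)
  finally show ?thesis
    by (simp add: pin_def linear2_add[OF linear_D])
qed

lemma pin_D: "pin (D f) = D (pin f)"
  by (rule commute_D[OF linear_pin pin_d])

lemma d_1: "d 1 = 0"
  using d_mult[of 1 1] by simp

lemma d_power: "d (v ^ k) = of_nat k * v ^ (k - 1)"
proof (induction k)
  case 0
  show ?case by (simp add: d_1)
next
  case (Suc k)
  then show ?case
    by (cases k) (simp_all add: d_mult d_v algebra_simps)
qed

text \<open>The factor \<open>L\<close> of \<open>D\<close> cancels one of the \<open>k + 1\<close>
  inverses, and \<open>d\<close> passes through the other \<open>k\<close> to lower
  \<open>v ^ k\<close>. For \<open>k > 0\<close> these are just the inverses that
  \<open>P (k - 1)\<close> needs; at \<open>k = 0\<close> both sides vanish.\<close>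

lemma D_P: "D (P k) = of_nat k * P (k - 1)"
proof -
  have "D (P k) = (inv L ^^ k) (d (v ^ k))"
    using funpow_commute[of d "inv L" k, OF commute_inv_L[OF linear_d refl]]
    by (simp add: D_def P_def)
  also have "\<dots> = of_nat k * (inv L ^^ k) (v ^ (k - 1))"
    by (simp add: d_power linear2_of_nat_mult[OF linear2_funpow[OF linear_inv_L]])
  also have "\<dots> = of_nat k * P (k - 1)"
    by (cases k) (simp_all add: P_def)
  finally show ?thesis .
qed

lemma D_B: "D (B k) = of_nat k * B (k - 1)"
  unfolding B_def pin_D[symmetric] D_P by (rule linear2_of_nat_mult[OF linear_pin])

definition L' :: op2
  where "L' f = L (v * f) - v * L f"

lemma linear_L': "linear2 L'"
  using linear2_pincherle[OF linear_L] by (simp add: L'_def[abs_def])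

lemma L'_d: "L' (d f) = d (L' f)"
proof -
  have "d (L' f) = L (d (v * f)) - L f - v * L (d f)"
    by (simp add: L'_def linear2_diff[OF linear_d] d_mult d_v d_L algebra_simps)
  also have "d (v * f) = f + v * d f"
    by (simp add: d_mult d_v)
  finally show ?thesis
    by (simp add: L'_def linear2_add[OF linear_L])
qed

lemma L'_inv_L: "L' (inv L f) = inv L (L' f)"
  by (rule commute_inv_L[OF linear_L' L'_d])

text \<open>The Pincherle derivative of \<open>L\<^sup>-\<^sup>k\<close> is \<open>- k L\<^sup>-\<^sup>k\<^sup>-\<^sup>1 L'\<close>.\<close>

lemma funpow_inv_L_mult:
  "(inv L ^^ k) (v * f) = v * (inv L ^^ k) f - of_nat k * (inv L ^^ (k + 1)) (L' f)"
proof (induction k)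
  case 0
  show ?case by simp
next
  case (Suc k)
  have step: "inv L (v * g) = v * inv L g - inv L (inv L (L' g))" for g
  proof -
    have "L (v * inv L g - inv L (inv L (L' g))) = L (v * inv L g) - L' (inv L g)"
      by (simp add: linear2_diff[OF linear_L] L'_inv_L)
    also have "\<dots> = v * g"
      by (simp add: L'_def)
    finally show ?thesis
      by (metis inv_L)
  qed
  have "L' ((inv L ^^ k) f) = (inv L ^^ k) (L' f)"
    by (rule funpow_commute) (rule L'_inv_L)
  then show ?case
    using Suc by (simp add: linear2_diff[OF linear_inv_L] linear2_of_nat_mult[OF linear_inv_L] step)
      (simp add: algebra_simps)
qed

text \<open>Product rule for Pincherle derivatives; that of \<open>d\<close> is the
  identity.\<close>

lemma pin_eq: "pin f = L f + d (L' f)"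
  by (simp add: pin_def L'_def D_def linear2_diff[OF linear_d] d_mult d_v)

text \<open>The second form of the transfer formula. Moving the \<open>k + 1\<close> inverses past
  \<open>v\<close> subtracts a multiple of \<open>L' (v ^ k)\<close> under \<open>k + 2\<close>
  inverses, and the summand of \<open>pin_eq\<close> containing \<open>L'\<close> restores exactly
  this term.\<close>

lemma B_Suc: "B (Suc k) = v * P k"
proof -
  have *: "L' ((inv L ^^ j) f) = (inv L ^^ j) (L' f)" "d ((inv L ^^ j) f) = (inv L ^^ j) (d f)" for j f
    by (auto intro!: funpow_commute commute_inv_L[OF linear_d refl] L'_inv_L)
  have "L (P (Suc k)) = (inv L ^^ Suc k) (v * v ^ k)"
    by (simp add: P_def)
  also have "\<dots> = v * P k - of_nat (Suc k) * (inv L ^^ (k + 2)) (L' (v ^ k))"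
    unfolding funpow_inv_L_mult by (simp add: P_def)
  finally have "B (Suc k) = v * P k - of_nat (Suc k) * (inv L ^^ (k + 2)) (L' (v ^ k))
      + L' (d (P (Suc k)))"
    by (simp only: B_def pin_eq L'_d)
  also have "L' (d (P (Suc k))) = of_nat (Suc k) * (inv L ^^ (k + 2)) (L' (v ^ k))"
    unfolding P_def * d_power
    by (simp only: * linear2_of_nat_mult[OF linear2_funpow[OF linear_inv_L]] linear2_of_nat_mult[OF linear_L']) simp
  finally show ?thesis by simp
qed

lemma d_inv_L_1: "d (inv L 1) = 0"
  using commute_inv_L[OF linear_d refl, of 1] by (simp add: d_1 linear2_0[OF linear_inv_L])

lemma B_0: "B 0 = 1"
proof -
  have "d (L' (P 0)) = 0"
    by (simp add: P_def d_inv_L_1 linear2_0[OF linear_L'] flip: L'_d)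
  then show ?thesis
    by (simp add: B_def pin_eq) (simp add: P_def)
qed

text \<open>The factor \<open>k\<close> extends \<open>B_Suc\<close> to \<open>k = 0\<close>, where
  the truncated index would otherwise give a false identity.\<close>

lemma v_mult_P: "of_nat k * (v * P (k - 1)) = of_nat k * B k"
  by (cases k) (simp_all add: B_Suc)

context
  fixes g assumes g: "d g = 0"
begin

text \<open>Multiplication by \<open>g\<close> is linear and commutes with \<open>d\<close> when
  \<open>d g = 0\<close>: operators in one variable treat polynomials in the other as
  scalars.\<close>

lemma L_mult_const: "L (g * f) = g * L f"
  by (rule commute_L[OF linear2_mult, symmetric]) (simp add: d_mult g)

lemma inv_L_mult_const: "inv L (g * f) = g * inv L f"
  by (rule commute_inv_L[OF linear2_mult, symmetric]) (simp add: d_mult g)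

lemma D_mult_const: "D (g * f) = g * D f"
  by (simp add: D_def L_mult_const d_mult g)

lemma pin_mult_const: "pin (g * f) = g * pin f"
  using D_mult_const[of "v * f"] D_mult_const[of f] by (simp add: pin_def algebra_simps)

lemma funpow_inv_L_mult_const: "(inv L ^^ k) (g * f) = g * (inv L ^^ k) f"
  by (induction k) (simp_all add: inv_L_mult_const)

end

context
  fixes e :: op2
  assumes linear_e: "linear2 e" and e_d: "\<And>f. e (d f) = d (e f)"
    and e_mult: "\<And>f g. e (f * g) = e f * g + f * e g" and e_v: "e v = 0"
begin

lemma other_derivation_power: "e (v ^ k) = 0"
  using e_mult[of 1 1] by (induction k) (simp_all add: e_mult e_v)

text \<open>For \<open>e\<close> the derivative in the other variable, \<open>P k\<close> does not
  involve that variable: \<open>e\<close> commutes with \<open>inv L\<close> and kills the powers of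
  \<open>v\<close>.\<close>

lemma other_derivation_P: "e (P k) = 0"
  unfolding P_def using funpow_commute[of e "inv L" "k + 1" "v ^ k"] commute_inv_L[OF linear_e e_d]
    linear2_0[OF linear2_funpow[OF linear_inv_L], of "k + 1"]
  by (simp only: other_derivation_power)

lemma other_derivation_B: "e (B k) = 0"
  using other_derivation_power[of 0] by (cases k) (simp_all add: B_0 B_Suc e_mult e_v other_derivation_P)

end

text \<open>Shifting turns \<open>v\<close> into \<open>v + r\<close>; the extra multiples of the
  shifted \<open>D f\<close> cancel in the commutator.\<close>

lemma pin_shift:
  assumes "\<And>f. shift a b (d f) = d (shift a b f)" "shift a b v = v + const2 r"
  shows "pin (shift a b f) = shift a b (pin f)"
proof -
  have D: "D (shift a b f) = shift a b (D f)" for f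
    using commute_D[OF linear2_shift assms(1)] by simp
  have "v * shift a b f = shift a b (v * f) - const2 r * shift a b f"
    by (simp add: shift_simps assms algebra_simps)
  then have "pin (shift a b f) = shift a b (D (v * f)) - const2 r * shift a b (D f) - v * shift a b (D f)"
    by (simp add: pin_def linear2_diff[OF linear_D] linear2_const2_mult[OF linear_D] D)
  also have "\<dots> = shift a b (pin f)"
    by (simp add: pin_def shift_simps assms algebra_simps)
  finally show ?thesis .
qed

end

section \<open>Separable pairs\<close>

locale separable_ops =
  X: delta_axis Dx L1 varX c1 + Y: delta_axis Dy L2 varY c2
  for L1 L2 :: op2 and c1 c2 :: "nat \<Rightarrow> real"
begin

section \<open>Commutation between the operators of the two variables\<close>

lemma Dy_XD: "X.D (Dy f) = Dy (X.D f)"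
  by (rule X.commute_D[OF linear2_Dy Dx_Dy[symmetric], symmetric])

lemma Dx_YD: "Y.D (Dx f) = Dx (Y.D f)"
  by (rule Y.commute_D[OF linear2_Dx Dx_Dy, symmetric])

lemma XD_YD: "X.D (Y.D f) = Y.D (X.D f)"
  by (rule Y.commute_D[OF X.linear_D Dy_XD])

lemma Xpin_Dy: "X.pin (Dy f) = Dy (X.pin f)"
  by (simp add: X.pin_def linear2_diff[OF linear2_Dy] Dy_mult flip: Dy_XD)

lemma Ypin_Dx: "Y.pin (Dx f) = Dx (Y.pin f)"
  by (simp add: Y.pin_def linear2_diff[OF linear2_Dx] Dx_mult flip: Dx_YD)

lemma Xpin_YD: "X.pin (Y.D f) = Y.D (X.pin f)"
  by (rule Y.commute_D[OF X.linear_pin Xpin_Dy])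

lemma Ypin_XD: "Y.pin (X.D f) = X.D (Y.pin f)"
  by (rule X.commute_D[OF Y.linear_pin Ypin_Dx])

lemma D_shift: "X.D (shift a b f) = shift a b (X.D f)" "Y.D (shift a b f) = shift a b (Y.D f)"
  by (simp_all add: X.commute_D[OF linear2_shift Dx_shift[symmetric]] Y.commute_D[OF linear2_shift Dy_shift[symmetric]])

lemma pin_shift: "X.pin (shift a b f) = shift a b (X.pin f)" "Y.pin (shift a b f) = shift a b (Y.pin f)"
  by (rule X.pin_shift Y.pin_shift; simp add: Dx_shift Dy_shift shift_simps)+

lemma other_derivative_eq_0:
  "Dy (X.P k) = 0" "Dy (X.B k) = 0" "Dx (Y.P k) = 0" "Dx (Y.B k) = 0"
  by (rule X.other_derivation_P X.other_derivation_B Y.other_derivation_P Y.other_derivation_B;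
      simp add: linear2_Dx linear2_Dy Dx_Dy Dx_mult Dy_mult)+

text \<open>Since \<open>L1\<close> and \<open>L2\<close> are injective and commute with their
  derivatives, both partial derivatives of \<open>g\<close> vanish, so \<open>g\<close> is a
  constant that is zero at \<open>z\<close>.\<close>

lemma eq_0_if_D_0:
  assumes "X.D g = 0" "Y.D g = 0" "eval2 g z = 0"
  shows "g = 0"
proof -
  have "g = const2 (coeff (coeff g 0) 0)"
    by (rule Dx_Dy_zero_imp_const2)
      (use assms in \<open>simp_all add: X.D_def Y.D_def X.d_L Y.d_L X.L_eq_0_iff Y.L_eq_0_iff\<close>)
  with assms(3) show ?thesis
    by (metis const2_simps(1) eval2_simps(7))
qed

text \<open>The point \<open>z\<close> may vary with \<open>(i, j)\<close>, as interpolation on a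
  grid requires. In the induction on \<open>K\<close>, \<open>X.D g\<close> and \<open>Y.D g\<close>
  inherit both hypotheses with a smaller bound, so they vanish and the point for
  \<open>(0, 0)\<close> finishes the argument.\<close>

lemma eq_0_if_functionals_0:
  assumes "\<And>i j. \<exists>z. eval2 ((X.D ^^ i) ((Y.D ^^ j) g)) z = 0"
    and "\<And>i j. i + j \<ge> K \<Longrightarrow> (X.D ^^ i) ((Y.D ^^ j) g) = 0"
  shows "g = 0"
  using assms
proof (induction K arbitrary: g)
  case 0
  from "0.prems"(2)[of 0 0] show ?case by simp
next
  case (Suc K)
  have XD: "(X.D ^^ i) ((Y.D ^^ j) (X.D g)) = (X.D ^^ Suc i) ((Y.D ^^ j) g)" for i j
    by (simp add: funpow_commute[of X.D Y.D, OF XD_YD, symmetric] funpow_swap1)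
  have YD: "(X.D ^^ i) ((Y.D ^^ j) (Y.D g)) = (X.D ^^ i) ((Y.D ^^ Suc j) g)" for i j
    by (simp add: funpow_swap1)
  have "X.D g = 0"
    by (rule Suc.IH; unfold XD; (rule Suc.prems)?) simp
  moreover have "Y.D g = 0"
    by (rule Suc.IH; unfold YD; (rule Suc.prems)?) simp
  moreover obtain z where "eval2 g z = 0"
    using Suc.prems(1)[of 0 0] by auto
  ultimately show ?case
    by (rule eq_0_if_D_0)
qed

section \<open>Products of univariate basic polynomials and their span\<close>

definition basic :: "nat \<Rightarrow> nat \<Rightarrow> bpoly"
  where "basic m n = X.B m * Y.B n"

lemma XD_product: "Dx g = 0 \<Longrightarrow> X.D (f * g) = X.D f * g"
  and YD_product: "Dy f = 0 \<Longrightarrow> Y.D (f * g) = f * Y.D g"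
  using X.D_mult_const[of g f] Y.D_mult_const[of f g] by (simp_all add: mult.commute)

lemma Xpin_product: "Dx g = 0 \<Longrightarrow> X.pin (f * g) = X.pin f * g"
  and Ypin_product: "Dy f = 0 \<Longrightarrow> Y.pin (f * g) = f * Y.pin g"
  using X.pin_mult_const[of g f] Y.pin_mult_const[of f g] by (simp_all add: mult.commute)

lemma D_basic: "X.D (basic m n) = of_nat m * basic (m - 1) n" "Y.D (basic m n) = of_nat n * basic m (n - 1)"
  by (simp_all add: basic_def XD_product YD_product other_derivative_eq_0 X.D_B Y.D_B mult_ac)

text \<open>Formulated for any family lowered in both indices, since it serves \<open>basic\<close>
  as well as \<open>PQ\<close>.\<close>

lemma funpow_D_product:
  assumes "\<And>m n. X.D (p m n) = of_nat m * p (m - 1) n" "\<And>m n. Y.D (p m n) = of_nat n * p m (n - 1)"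
  shows "(X.D ^^ i) ((Y.D ^^ j) (p m n)) =
    of_nat ((\<Prod>k<i. m - k) * (\<Prod>k<j. n - k)) * p (m - i) (n - j)"
proof -
  have Y: "(Y.D ^^ j) (p m n) = of_nat (\<Prod>k<j. n - k) * p m (n - j)"
    by (rule funpow_lowering[OF Y.linear_D assms(2)])
  have X: "(X.D ^^ i) (p m (n - j)) = of_nat (\<Prod>k<i. m - k) * p (m - i) (n - j)"
    by (rule funpow_lowering[OF X.linear_D, of "\<lambda>m. p m (n - j)", OF assms(1)])
  show ?thesis
    unfolding Y linear2_of_nat_mult[OF linear2_funpow[OF X.linear_D]] X by (simp only: of_nat_mult mult_ac)
qed

lemma falling_prod_self: "(\<Prod>k<m. m - k) = (fact m :: nat)"
  by (simp add: fact_prod_rev lessThan_atLeast0)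

lemma falling_prod_eq_0: "m < i \<Longrightarrow> (\<Prod>k<i. m - k) = (0 :: nat)"
  by (auto intro: bexI[of _ m])

lemma eval2_B_0: "eval2 (X.B m) 0 = (if m = 0 then 1 else 0)" "eval2 (Y.B m) 0 = (if m = 0 then 1 else 0)"
  by (cases m; simp add: X.B_0 X.B_Suc Y.B_0 Y.B_Suc)+

text \<open>Duality at the origin, which yields the Taylor coefficients in
  \<open>span_basic\<close>. An index of \<open>basic\<close> that is too small gives a zero falling
  product, one that is too large leaves a basic polynomial vanishing at the origin.\<close>

lemma eval2_D_basic:
  "eval2 ((X.D ^^ k) ((Y.D ^^ l) (basic i j))) 0 = (if i = k \<and> j = l then fact k * fact l else 0)"
proof -
  have "eval2 ((X.D ^^ k) ((Y.D ^^ l) (basic i j))) 0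
      = real ((\<Prod>x<k. i - x) * (\<Prod>x<l. j - x)) * eval2 (basic (i - k) (j - l)) 0"
    by (simp only: funpow_D_product[of basic, OF D_basic] eval2_simps eval2_of_nat)
  then show ?thesis
    using falling_prod_self[of i] falling_prod_self[of j] falling_prod_eq_0[of i k] falling_prod_eq_0[of j l]
    by (cases "i < k"; cases "j < l"; cases "i = k"; cases "j = l")
      (auto simp: basic_def eval2_B_0 simp del: of_nat_prod)
qed

text \<open>By \<open>span_basic\<close> this is the span in the definition of Goncarov polynomials;
  membership becomes a matter of two operator equations.\<close>

definition kernel :: "nat \<Rightarrow> nat \<Rightarrow> bpoly set"
  where "kernel m n = {f. (X.D ^^ Suc m) f = 0 \<and> (Y.D ^^ Suc n) f = 0}"

lemma kernel_D_eq_0: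
  assumes "f \<in> kernel m n" "m < i \<or> n < j"
  shows "(X.D ^^ i) ((Y.D ^^ j) f) = 0"
proof -
  have comm: "(X.D ^^ i) ((Y.D ^^ j) f) = (Y.D ^^ j) ((X.D ^^ i) f)"
    by (rule funpow_funpow_commute) (rule XD_YD)
  have 1: "(X.D ^^ i) f = 0" if "m < i"
    using assms(1) that funpow_eq_0_mono[OF X.linear_D, of "Suc m" f i]
    by (simp add: kernel_def del: funpow.simps)
  have 2: "(Y.D ^^ j) f = 0" if "n < j"
    using assms(1) that funpow_eq_0_mono[OF Y.linear_D, of "Suc n" f j]
    by (simp add: kernel_def del: funpow.simps)
  show ?thesis
  proof (cases "m < i")
    case True
    then show ?thesis
      unfolding comm using 1 linear2_0[OF linear2_funpow[OF Y.linear_D]] by simp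
  next
    case False
    then show ?thesis
      using 2 assms(2) linear2_0[OF linear2_funpow[OF X.linear_D]] by simp
  qed
qed

lemma kernel_eq_0:
  assumes "g \<in> kernel m n"
    and "\<And>i j. i \<le> m \<Longrightarrow> j \<le> n \<Longrightarrow> \<exists>z. eval2 ((X.D ^^ i) ((Y.D ^^ j) g)) z = 0"
  shows "g = 0"
\<comment> \<open>If \<open>i + j > m + n\<close>, then \<open>i > m\<close> or
  \<open>j > n\<close>, and \<open>kernel_D_eq_0\<close> applies.\<close>
proof (rule eq_0_if_functionals_0[where K = "Suc (m + n)"])
  show "\<exists>z. eval2 ((X.D ^^ i) ((Y.D ^^ j) g)) z = 0" for i j
  proof (cases "i \<le> m \<and> j \<le> n")
    case False
    then show ?thesis
      by (subst kernel_D_eq_0[OF assms(1)]) auto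
  qed (use assms(2) in blast)
  show "(X.D ^^ i) ((Y.D ^^ j) g) = 0" if "Suc (m + n) \<le> i + j" for i j
    by (rule kernel_D_eq_0[OF assms(1)]) (use that in linarith)
qed

lemma subspace_kernel: "scale2.subspace (kernel m n)"
  unfolding scale2.subspace_def kernel_def
  by (simp add: linear2_0[OF linear2_funpow] linear2_add[OF linear2_funpow]
      linear2_scale[OF linear2_funpow] X.linear_D Y.linear_D del: funpow.simps)

lemma basic_in_kernel: "i \<le> m \<Longrightarrow> j \<le> n \<Longrightarrow> basic i j \<in> kernel m n"
  using funpow_D_product[of basic "Suc m" 0 i j, OF D_basic] funpow_D_product[of basic 0 "Suc n" i j, OF D_basic]
    falling_prod_eq_0[of i "Suc m"] falling_prod_eq_0[of j "Suc n"]
  by (simp add: kernel_def del: funpow.simps prod.lessThan_Suc)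

text \<open>Taylor expansion at the origin with respect to the basic sequence.\<close>

lemma span_basic: "scale2.span {basic i j |i j. i \<le> m \<and> j \<le> n} = kernel m n"
proof
  show sub: "scale2.span {basic i j |i j. i \<le> m \<and> j \<le> n} \<subseteq> kernel m n"
    by (rule scale2.span_minimal) (auto simp: basic_in_kernel subspace_kernel)
  show "kernel m n \<subseteq> scale2.span {basic i j |i j. i \<le> m \<and> j \<le> n}"
  proof
    fix f assume f: "f \<in> kernel m n"
    define r where "r i j = eval2 ((X.D ^^ i) ((Y.D ^^ j) f)) 0 / (fact i * fact j)" for i j
    define g where "g = (\<Sum>i\<le>m. \<Sum>j\<le>n. scale2 (r i j) (basic i j))"
    have g: "g \<in> scale2.span {basic i j |i j. i \<le> m \<and> j \<le> n}"
      unfolding g_def by (intro scale2.span_sum scale2.span_scale scale2.span_base) auto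
    then have "g \<in> kernel m n"
      using sub by blast
    then have "f - g \<in> kernel m n"
      by (rule scale2.subspace_diff[OF subspace_kernel f])
    then have "f - g = 0"
    proof (rule kernel_eq_0)
      fix k l assume kl: "k \<le> m" "l \<le> n"
      let ?Q = "\<lambda>f. (X.D ^^ k) ((Y.D ^^ l) f)"
      have Q: "linear2 ?Q"
        by (rule linear2_compose[OF linear2_funpow[OF X.linear_D] linear2_funpow[OF Y.linear_D]])
      have "eval2 (?Q g) 0 = (\<Sum>i\<le>m. \<Sum>j\<le>n. r i j * eval2 (?Q (basic i j)) 0)"
        unfolding g_def linear2_sum[OF Q] linear2_scale[OF Q] by (simp add: eval2_sum scale2_eq)
      also have "\<dots> = (\<Sum>i\<le>m. \<Sum>j\<le>n. if j = l then if i = k then r i j * (fact k * fact l) else 0 else 0)"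
        by (intro sum.cong) (auto simp: eval2_D_basic)
      also have "\<dots> = r k l * (fact k * fact l)"
        using kl by (simp add: sum.delta)
      also have "\<dots> = eval2 (?Q f) 0"
        by (simp add: r_def)
      finally show "\<exists>z. eval2 (?Q (f - g)) z = 0"
        by (intro exI[of _ 0]) (simp add: linear2_diff[OF Q])
    qed
    with g show "f \<in> scale2.span {basic i j |i j. i \<le> m \<and> j \<le> n}" by simp
  qed
qed

section \<open>The bivariate basic sequence: degree and uniqueness\<close>

lemma total_degree_basic: "total_degree (basic m n) = m + n"
proof (rule total_degree_eqI)
  \<comment> \<open>Powers of \<open>X.D\<close> and \<open>Dx\<close> differ by a power of the
    injective \<open>L1\<close>, so they annihilate the same polynomials; likewise in
    \<open>y\<close>.\<close>
  have Xpow: "(X.D ^^ k) f = (L1 ^^ k) ((Dx ^^ k) f)" for k f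
    by (induction k) (simp_all add: X.D_def X.d_L funpow_commute[of Dx L1, OF X.d_L])
  have Ypow: "(Y.D ^^ k) f = (L2 ^^ k) ((Dy ^^ k) f)" for k f
    by (induction k) (simp_all add: Y.D_def Y.d_L funpow_commute[of Dy L2, OF Y.d_L])
  have XL0: "(L1 ^^ k) f = 0 \<Longrightarrow> f = 0" and YL0: "(L2 ^^ k) f = 0 \<Longrightarrow> f = 0" for k f
    by (induction k) (simp_all add: X.L_eq_0_iff Y.L_eq_0_iff)
  have kernel: "basic m n \<in> kernel m n"
    by (simp add: basic_in_kernel)
  have Dx_0: "(Dx ^^ Suc m) (basic m n) = 0"
    by (rule XL0[of "Suc m"]) (use kernel in \<open>simp only: kernel_def mem_Collect_eq flip: Xpow\<close>)
  have Dy_0: "(Dy ^^ Suc n) (basic m n) = 0"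
    by (rule YL0[of "Suc n"]) (use kernel in \<open>simp only: kernel_def mem_Collect_eq flip: Ypow\<close>)
  show le: "i \<le> m \<and> j \<le> n" if "coeff (coeff (basic m n) j) i \<noteq> 0" for i j
  proof (rule ccontr)
    assume "\<not> (i \<le> m \<and> j \<le> n)"
    then consider k where "i = k + Suc m" | k where "j = k + Suc n"
      by (metis add.commute le_add_diff_inverse not_less_eq_eq)
    then show False
    proof cases
      case 1
      then show False
        using that coeff_funpow_Dx[of "Suc m" k] Dx_0 by (metis coeff_0 mult_eq_0_iff)
    next
      case 2
      then show False
        using that coeff_funpow_Dy[of "Suc n" k] Dy_0 by (metis coeff_0 mult_eq_0_iff)
    qed
  qed
  \<comment> \<open>Nonzero by duality at the origin. Stripping off \<open>L1\<close> and
    \<open>L2\<close> gives a nonzero coefficient with exponents at least \<open>m\<close> and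
    \<open>n\<close>, and the bound \<open>le\<close> forces equality.\<close>
  have "(X.D ^^ m) ((Y.D ^^ n) (basic m n)) \<noteq> 0"
    using eval2_D_basic[of m n m n] by auto
  then have "(Dx ^^ m) ((Y.D ^^ n) (basic m n)) \<noteq> 0"
    using linear2_0[OF linear2_funpow[OF X.linear_L]] by (auto simp: Xpow)
  moreover have "(Dx ^^ m) ((Y.D ^^ n) (basic m n)) = (Y.D ^^ n) ((Dx ^^ m) (basic m n))"
    by (rule funpow_funpow_commute) (rule Dx_YD[symmetric])
  ultimately have "(Dy ^^ n) ((Dx ^^ m) (basic m n)) \<noteq> 0"
    using linear2_0[OF linear2_funpow[OF Y.linear_L]] by (auto simp: Ypow)
  then obtain i j where "coeff (coeff ((Dy ^^ n) ((Dx ^^ m) (basic m n))) j) i \<noteq> 0"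
    using bpoly_eqI[of "(Dy ^^ n) ((Dx ^^ m) (basic m n))" 0] by auto
  then have "coeff (coeff ((Dx ^^ m) (basic m n)) (j + n)) i \<noteq> 0"
    using coeff_funpow_Dy[of n j] by (metis mult_zero_right)
  then have *: "coeff (coeff (basic m n) (j + n)) (i + m) \<noteq> 0"
    using coeff_funpow_Dx[of m i] by (metis mult_zero_right)
  with le[OF *] show "coeff (coeff (basic m n) n) m \<noteq> 0"
    by simp
qed

lemma basic_0_0: "basic 0 0 = 1"
  by (simp add: basic_def X.B_0 Y.B_0)

lemma eval2_basic_0: "eval2 (basic m n) 0 = (if m = 0 \<and> n = 0 then 1 else 0)"
  by (simp add: basic_def eval2_B_0)

lemma is_basic_sequence_basic: "is_basic_sequence X.D Y.D basic"
  unfolding is_basic_sequence_def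
  by (auto simp: total_degree_basic D_basic scale2_eq basic_0_0 eval2_basic_0)

text \<open>Induction on \<open>m + n\<close>: by the lowering rules both delta operators kill the
  difference of two basic sequences at \<open>(m, n)\<close>, and it vanishes at the origin. A zero
  index contributes the factor 0.\<close>

lemma basic_sequence_eq: "basic_sequence X.D Y.D = basic"
  unfolding basic_sequence_def
proof (rule the_equality)
  show "is_basic_sequence X.D Y.D basic"
    by (rule is_basic_sequence_basic)
next
  fix p assume p: "is_basic_sequence X.D Y.D p"
  have "p m n - basic m n = 0" for m n
  proof (induction "m + n" arbitrary: m n rule: less_induct)
    case less
    show ?case
    proof (cases "(m, n) = (0, 0)")
      case True
      then show ?thesis
        using p is_basic_sequence_basic by (simp add: is_basic_sequence_def)
    next
      case False
      have D: "X.D (p m n - basic m n) = of_nat m * (p (m - 1) n - basic (m - 1) n)"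
        "Y.D (p m n - basic m n) = of_nat n * (p m (n - 1) - basic m (n - 1))"
        using p by (simp_all add: is_basic_sequence_def D_basic scale2_eq algebra_simps
            linear2_diff[OF X.linear_D] linear2_diff[OF Y.linear_D])
      show ?thesis
      proof (rule eq_0_if_D_0)
        show "X.D (p m n - basic m n) = 0"
          unfolding D using less[of "m - 1" n] by (cases m) simp_all
        show "Y.D (p m n - basic m n) = 0"
          unfolding D using less[of m "n - 1"] by (cases n) simp_all
        have "eval2 (p m n) 0 = 0"
          using False p unfolding is_basic_sequence_def by blast
        with False show "eval2 (p m n - basic m n) 0 = 0"
          by (simp add: eval2_basic_0)
      qed
    qed
  qed
  then show "p = basic"
    by (intro ext) simp
qed

text \<open>The difference of two solutions lies in \<open>kernel m n\<close>, and each functional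
  of it vanishes at its own grid point.\<close>

lemma is_goncarov_unique:
  assumes "is_goncarov X.D Y.D Z m n f" "is_goncarov X.D Y.D Z m n g"
  shows "f = g"
proof -
  have "f - g = 0"
  proof (rule kernel_eq_0)
    show "f - g \<in> kernel m n"
      using assms by (intro scale2.subspace_diff[OF subspace_kernel])
        (simp_all add: is_goncarov_def basic_sequence_eq span_basic)
    fix i j assume "i \<le> m" "j \<le> n"
    then show "\<exists>z. eval2 ((X.D ^^ i) ((Y.D ^^ j) (f - g))) z = 0"
      using assms by (intro exI[of _ "Z i j"])
        (simp add: is_goncarov_def linear2_diff[OF linear2_funpow] X.linear_D Y.linear_D)
  qed
  then show ?thesis by simp
qed

lemma goncarov_eqI: "is_goncarov X.D Y.D Z m n t \<Longrightarrow> goncarov X.D Y.D Z m n = t"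
  unfolding goncarov_def using is_goncarov_unique by blast

text \<open>Induction with \<open>eq_0_if_D_0\<close>, whose condition on \<open>Y.D\<close> holds
  because neither \<open>embed_x (p k)\<close> nor \<open>X.B k\<close> involves
  \<open>y\<close>.\<close>

lemma is_univariate_basic_sequence_x:
  assumes p: "is_univariate_basic_sequence embed_x X.D p"
  shows "embed_x (p k) = X.B k"
proof -
  have "embed_x (p k) - X.B k = 0"
  proof (induction k)
    case 0
    then show ?case
      using p by (simp add: is_univariate_basic_sequence_def X.B_0 embed_x_def one_pCons)
  next
    case (Suc k)
    show ?case
    proof (rule eq_0_if_D_0)
      show "X.D (embed_x (p (Suc k)) - X.B (Suc k)) = 0"
        using p Suc by (simp add: is_univariate_basic_sequence_def linear2_diff[OF X.linear_D] X.D_B scale2_eq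
            del: of_nat_Suc)
      have "Dy (embed_x (p (Suc k)) - X.B (Suc k)) = 0"
        by (simp add: linear2_diff[OF linear2_Dy] other_derivative_eq_0) (simp add: Dy_def embed_x_def)
      then show "Y.D (embed_x (p (Suc k)) - X.B (Suc k)) = 0"
        by (simp add: Y.D_def Y.d_L linear2_0[OF Y.linear_L])
      show "eval2 (embed_x (p (Suc k)) - X.B (Suc k)) 0 = 0"
        using p by (simp add: is_univariate_basic_sequence_def eval2_B_0) (simp add: eval2_def embed_x_def)
    qed
  qed
  then show ?thesis by simp
qed

lemma is_univariate_basic_sequence_y:
  assumes q: "is_univariate_basic_sequence embed_y Y.D q"
  shows "embed_y (q k) = Y.B k"
proof -
  have "embed_y (q k) - Y.B k = 0"
  proof (induction k)
    case 0
    then show ?case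
      using q by (simp add: is_univariate_basic_sequence_def Y.B_0 embed_y_def one_pCons map_poly_pCons)
  next
    case (Suc k)
    show ?case
    proof (rule eq_0_if_D_0)
      show "Y.D (embed_y (q (Suc k)) - Y.B (Suc k)) = 0"
        using q Suc by (simp add: is_univariate_basic_sequence_def linear2_diff[OF Y.linear_D] Y.D_B scale2_eq
            del: of_nat_Suc)
      have "Dx (embed_y f) = 0" for f
        by (rule bpoly_eqI) (simp add: coeff_coeff_Dx embed_y_def coeff_map_poly)
      then have "Dx (embed_y (q (Suc k)) - Y.B (Suc k)) = 0"
        by (simp add: linear2_diff[OF linear2_Dx] other_derivative_eq_0)
      then show "X.D (embed_y (q (Suc k)) - Y.B (Suc k)) = 0"
        by (simp add: X.D_def X.d_L linear2_0[OF X.linear_L])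
      show "eval2 (embed_y (q (Suc k)) - Y.B (Suc k)) 0 = 0"
        using q by (simp add: is_univariate_basic_sequence_def eval2_B_0 eval2_embed_y)
    qed
  qed
  then show ?thesis by simp
qed

end

section \<open>Delta Abel polynomials\<close>

locale abel = separable_ops L1 L2 c1 c2
  for L1 L2 c1 c2 +
  fixes a11 a12 a21 a22 :: real
begin

definition grid :: "nat \<Rightarrow> nat \<Rightarrow> real^2"
  where "grid i j = vector [a11 * real i + a12 * real j, a21 * real i + a22 * real j]"

text \<open>The determinant of (iii); by \<open>op_jacobian_eq\<close> the Jacobian of (ii) is
  \<open>J\<close> composed with both shifts.\<close>

definition J :: op2
  where "J = op_det
    (\<lambda>f. X.pin f + scale2 a11 (X.D f)) (\<lambda>f. scale2 a21 (X.D f))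
    (\<lambda>f. scale2 a12 (Y.D f)) (\<lambda>f. Y.pin f + scale2 a22 (Y.D f))"

lemma J_eq: "J f = X.pin (Y.pin f) + const2 a22 * X.pin (Y.D f) + const2 a11 * X.D (Y.pin f)
  + const2 (a11 * a22 - a12 * a21) * X.D (Y.D f)"
  by (simp add: J_def op_det_def scale2_eq linear2_add[OF X.linear_pin] linear2_add[OF X.linear_D]
      linear2_const2_mult[OF X.linear_pin] linear2_const2_mult[OF X.linear_D] algebra_simps)

lemma J_commute:
  assumes Q: "linear2 Q" and "\<And>f. Q (X.D f) = X.D (Q f)" "\<And>f. Q (Y.D f) = Y.D (Q f)"
    "\<And>f. Q (X.pin f) = X.pin (Q f)" "\<And>f. Q (Y.pin f) = Y.pin (Q f)"
  shows "Q (J f) = J (Q f)"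
  unfolding J_eq by (simp only: linear2_add[OF Q] linear2_const2_mult[OF Q] assms)

lemma J_XD: "X.D (J f) = J (X.D f)"
  by (rule J_commute) (simp_all add: X.linear_D XD_YD X.pin_D Ypin_XD)

lemma J_YD: "Y.D (J f) = J (Y.D f)"
  by (rule J_commute) (simp_all add: Y.linear_D XD_YD Y.pin_D Xpin_YD)

lemma J_shift: "shift a b (J f) = J (shift a b f)"
  by (rule J_commute) (simp_all add: linear2_shift D_shift pin_shift)

lemma linear_J: "linear2 J"
  unfolding linear2_iff scale2_eq
proof (intro conjI allI)
  note lin = X.linear_D Y.linear_D X.linear_pin Y.linear_pin
  show "J (f + g) = J f + J g" for f g
    by (simp only: J_eq lin[THEN linear2_add]) (simp add: algebra_simps)
  show "J (const2 r * f) = const2 r * J f" for r f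
    by (simp only: J_eq lin[THEN linear2_const2_mult]) (simp add: algebra_simps)
qed

definition PQ :: "nat \<Rightarrow> nat \<Rightarrow> bpoly"
  where "PQ m n = X.P m * Y.P n"

lemma D_PQ: "X.D (PQ m n) = of_nat m * PQ (m - 1) n" "Y.D (PQ m n) = of_nat n * PQ m (n - 1)"
  by (simp_all add: PQ_def XD_product YD_product other_derivative_eq_0 X.D_P Y.D_P mult_ac)

text \<open>The inverses in one variable treat powers of the other as scalars, so the mixed operator
  splits into a product.\<close>

lemma PQ_eq: "(inv L1 ^^ (m + 1)) ((inv L2 ^^ (n + 1)) (varX ^ m * varY ^ n)) = PQ m n"
proof -
  have "Dy (varX ^ m) = 0"
    by (rule X.other_derivation_power) (simp_all add: linear2_Dy Dx_Dy Dy_mult)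
  then have "(inv L2 ^^ (n + 1)) (varX ^ m * varY ^ n) = Y.P n * varX ^ m"
    unfolding Y.P_def by (simp only: Y.funpow_inv_L_mult_const mult.commute)
  moreover have "(inv L1 ^^ (m + 1)) (Y.P n * varX ^ m) = Y.P n * (inv L1 ^^ (m + 1)) (varX ^ m)"
    by (rule X.funpow_inv_L_mult_const[OF other_derivative_eq_0(3)])
  ultimately show ?thesis
    by (simp only: PQ_def X.P_def mult.commute)
qed

text \<open>Each operator acts on one factor of \<open>PQ m n\<close>: \<open>pin\<close> turns
  \<open>P\<close> into \<open>B\<close>, and the delta operators lower \<open>P\<close>.\<close>

lemma J_PQ: "J (PQ m n) =
  (X.B m + const2 a11 * (of_nat m * X.P (m - 1))) * (Y.B n + const2 a22 * (of_nat n * Y.P (n - 1)))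
  - const2 (a12 * a21) * (of_nat m * X.P (m - 1)) * (of_nat n * Y.P (n - 1))"
proof -
  have "X.pin (PQ m n) = X.B m * Y.P n" "Y.pin (PQ m n) = X.P m * Y.B n"
    "X.pin (X.P m * Y.B n) = X.B m * Y.B n" "X.D (X.P m * Y.B n) = of_nat m * X.P (m - 1) * Y.B n" for m n
    by (simp_all add: PQ_def XD_product Xpin_product Ypin_product other_derivative_eq_0 X.D_P X.B_def[symmetric]
        Y.B_def[symmetric])
  then show ?thesis
    by (simp only: J_eq D_PQ linear2_of_nat_mult[OF X.linear_D] linear2_of_nat_mult[OF X.linear_pin])
      (simp add: PQ_def algebra_simps)
qed

text \<open>For positive \<open>k\<close> and \<open>l\<close> the two products of the determinant
  both contain \<open>a12 * l * a21 * k\<close> at this point and cancel. If exactly one index is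
  zero, the second product drops out and the linear factor of the other variable vanishes.\<close>

lemma eval2_J_PQ:
  assumes "z $ 1 = - (a11 * real k + a12 * real l)" "z $ 2 = - (a21 * real k + a22 * real l)"
  shows "eval2 (J (PQ k l)) z = (if k = 0 \<and> l = 0 then 1 else 0)"
  by (cases k; cases l) (simp_all add: J_PQ X.B_0 X.B_Suc Y.B_0 Y.B_Suc assms algebra_simps)

definition t :: "nat \<Rightarrow> nat \<Rightarrow> bpoly"
  where "t m n = shift (- (grid m n $ 1)) (- (grid m n $ 2)) (J (PQ m n))"

text \<open>The delta operators lower the argument of \<open>J\<close> while the shift keeps the
  original index \<open>(m, n)\<close>.\<close>

lemma D_t: "(X.D ^^ i) ((Y.D ^^ j) (t m n)) =
  shift (- (grid m n $ 1)) (- (grid m n $ 2))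
    (of_nat ((\<Prod>k<i. m - k) * (\<Prod>k<j. n - k)) * J (PQ (m - i) (n - j)))"
proof -
  let ?S = "shift (- (grid m n $ 1)) (- (grid m n $ 2))"
  have X: "(X.D ^^ i) (?S f) = ?S ((X.D ^^ i) f)" and Y: "(Y.D ^^ j) (?S f) = ?S ((Y.D ^^ j) f)" for f
    by (rule funpow_commute[of ?S, symmetric], simp add: D_shift)+
  have JX: "(X.D ^^ i) (J f) = J ((X.D ^^ i) f)" and JY: "(Y.D ^^ j) (J f) = J ((Y.D ^^ j) f)" for f
    by (rule funpow_commute[of J, symmetric], simp add: J_XD J_YD)+
  show ?thesis
    unfolding t_def X Y JX JY funpow_D_product[of PQ, OF D_PQ] linear2_of_nat_mult[OF linear_J] ..
qed

text \<open>Linearity of the grid is decisive: at the node of \<open>(i, j)\<close> the shift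
  evaluates \<open>J (PQ (m - i) (n - j))\<close> at the negative of the node of
  \<open>(m - i, n - j)\<close>, which is the point in \<open>eval2_J_PQ\<close>. Membership in
  \<open>kernel m n\<close> comes from zero falling products.\<close>

lemma is_goncarov_t: "is_goncarov X.D Y.D grid m n (t m n)"
  unfolding is_goncarov_def basic_sequence_eq span_basic
proof (intro conjI allI impI)
  have zero: "shift a b 0 = 0" for a b
    by (rule linear2_0[OF linear2_shift])
  show "t m n \<in> kernel m n"
    using D_t[of "Suc m" 0 m n] D_t[of 0 "Suc n" m n]
      falling_prod_eq_0[of m "Suc m"] falling_prod_eq_0[of n "Suc n"]
    by (simp add: kernel_def zero del: funpow.simps prod.lessThan_Suc)
  fix i j assume ij: "i \<le> m" "j \<le> n"
  have "eval2 ((X.D ^^ i) ((Y.D ^^ j) (t m n))) (grid i j) =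
      real ((\<Prod>k<i. m - k) * (\<Prod>k<j. n - k)) *
      eval2 (J (PQ (m - i) (n - j))) (grid i j + vector [- (grid m n $ 1), - (grid m n $ 2)])"
    unfolding D_t eval2_shift eval2_simps eval2_of_nat ..
  also have "eval2 (J (PQ (m - i) (n - j))) (grid i j + vector [- (grid m n $ 1), - (grid m n $ 2)])
      = (if m - i = 0 \<and> n - j = 0 then 1 else 0)"
    by (rule eval2_J_PQ) (use ij in \<open>simp_all add: grid_def of_nat_diff algebra_simps\<close>)
  finally show "eval2 ((X.D ^^ i) ((Y.D ^^ j) (t m n))) (grid i j) =
      (if i = m \<and> j = n then fact m * fact n else 0)"
    using ij falling_prod_self[of m] falling_prod_self[of n] by (auto simp del: of_nat_prod)
qed

lemma goncarov_grid: "goncarov X.D Y.D grid m n = t m n"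
  by (rule goncarov_eqI) (rule is_goncarov_t)

text \<open>Multiplying by both variables turns every lowered \<open>P\<close> into \<open>B\<close>
  by \<open>v_mult_P\<close>, also for zero indices, so a quadratic factor splits off.\<close>

lemma mult_J_PQ:
  "varX * varY * J (PQ m n) =
    ((varX + const2 (a11 * real m)) * (varY + const2 (a22 * real n)) - const2 (a12 * real n * (a21 * real m)))
    * (X.B m * Y.B n)"
proof -
  have B: "varX * (X.B m + const2 a11 * (of_nat m * X.P (m - 1))) = (varX + const2 (a11 * real m)) * X.B m"
    "varY * (Y.B n + const2 a22 * (of_nat n * Y.P (n - 1))) = (varY + const2 (a22 * real n)) * Y.B n"
    using X.v_mult_P[of m] Y.v_mult_P[of n] by (simp_all add: algebra_simps)
  have P: "varX * (of_nat m * X.P (m - 1)) = of_nat m * X.B m" "varY * (of_nat n * Y.P (n - 1)) = of_nat n * Y.B n"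
    using X.v_mult_P[of m] Y.v_mult_P[of n] by (simp_all add: mult_ac)
  have "varX * varY * (f * g - r * h * k) = (varX * f) * (varY * g) - r * (varX * h) * (varY * k)" for f g h k r
    by (simp add: algebra_simps)
  then have "varX * varY * J (PQ m n) = ((varX + const2 (a11 * real m)) * X.B m) * ((varY + const2 (a22 * real n)) * Y.B n)
    - const2 (a12 * a21) * (of_nat m * X.B m) * (of_nat n * Y.B n)"
    by (simp only: J_PQ B P)
  then show ?thesis
    by (simp add: algebra_simps)
qed

lemma mult_t:
  "(varX - const2 (grid m n $ 1)) * (varY - const2 (grid m n $ 2)) * t m n =
    ((varX - const2 (grid 0 n $ 1)) * (varY - const2 (grid m 0 $ 2)) - const2 (grid m 0 $ 2) * const2 (grid 0 n $ 1))
    * (shift (- (grid m n $ 1)) (- (grid m n $ 2)) (X.B m) * shift (- (grid m n $ 1)) (- (grid m n $ 2)) (Y.B n))"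
proof -
  let ?S = "shift (- (grid m n $ 1)) (- (grid m n $ 2))"
  have "(varX - const2 (grid m n $ 1)) * (varY - const2 (grid m n $ 2)) * t m n = ?S (varX * varY * J (PQ m n))"
    by (simp add: t_def shift_simps)
  also have "\<dots> = ?S ((varX + const2 (a11 * real m)) * (varY + const2 (a22 * real n))
      - const2 (a12 * real n * (a21 * real m))) * (?S (X.B m) * ?S (Y.B n))"
    by (simp only: mult_J_PQ shift_simps(4))
  \<comment> \<open>In the grid, \<open>a11 * m\<close> minus the first coordinate at
    \<open>(m, n)\<close> is minus that at \<open>(0, n)\<close>; similarly for the second
    coordinate and \<open>(m, 0)\<close>.\<close>
  also have "?S ((varX + const2 (a11 * real m)) * (varY + const2 (a22 * real n)) - const2 (a12 * real n * (a21 * real m)))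
    = (varX - const2 (grid 0 n $ 1)) * (varY - const2 (grid m 0 $ 2)) - const2 (grid m 0 $ 2) * const2 (grid 0 n $ 1)"
    by (simp add: shift_simps shift_of_nat grid_def algebra_simps)
  finally show ?thesis .
qed

section \<open>The two operator formulas\<close>

abbreviation "E1 \<equiv> shift a11 a21"
abbreviation "E2 \<equiv> shift a12 a22"

text \<open>Moving a variable through a shift adds a constant, so each Pincherle derivative gains a
  multiple of the delta operator. Off the diagonal only this multiple remains. The rows share the
  factors \<open>E1\<close> and \<open>E2\<close>, which pull out.\<close>

lemma op_jacobian_eq: "op_jacobian (Dx \<circ> L1 \<circ> E1) (Dy \<circ> L2 \<circ> E2) f = J (E1 (E2 f))"
proof -
  have X: "(Dx \<circ> L1 \<circ> E1) f = X.D (E1 f)" and Y: "(Dy \<circ> L2 \<circ> E2) f = Y.D (E2 f)" for f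
    by (simp_all add: X.D_def Y.D_def)
  have 1: "pincherle_x (Dx \<circ> L1 \<circ> E1) f = X.pin (E1 f) + const2 a11 * X.D (E1 f)" for f
    unfolding pincherle_x_def X shift_simps by (simp add: X.pin_def distrib_right linear2_add[OF X.linear_D]
        linear2_const2_mult[OF X.linear_D])
  have 2: "pincherle_y (Dy \<circ> L2 \<circ> E2) f = Y.pin (E2 f) + const2 a22 * Y.D (E2 f)" for f
    unfolding pincherle_y_def Y shift_simps by (simp add: Y.pin_def distrib_right linear2_add[OF Y.linear_D]
        linear2_const2_mult[OF Y.linear_D])
  have 3: "pincherle_y (Dx \<circ> L1 \<circ> E1) f = const2 a21 * X.D (E1 f)" for f
    unfolding pincherle_y_def X shift_simps by (simp add: distrib_right linear2_add[OF X.linear_D]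
        linear2_const2_mult[OF X.linear_D] X.D_mult_const)
  have 4: "pincherle_x (Dy \<circ> L2 \<circ> E2) f = const2 a12 * Y.D (E2 f)" for f
    unfolding pincherle_x_def Y shift_simps by (simp add: distrib_right linear2_add[OF Y.linear_D]
        linear2_const2_mult[OF Y.linear_D] Y.D_mult_const)
  have E: "E2 (E1 f) = E1 (E2 f)" for f
    by (simp add: shift_shift add.commute)
  show ?thesis
    by (simp add: op_jacobian_def op_det_def 1 2 3 4 J_def scale2_eq E shift_simps D_shift pin_shift)
qed

lemma t_eq_J: "t m n = J ((inv E1 ^^ m) ((inv E2 ^^ n) (PQ m n)))"
  by (simp add: t_def J_shift inv_shift funpow_shift shift_shift grid_def algebra_simps)

text \<open>Compared with \<open>t_eq_J\<close>, one additional inverse of each shift compensates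
  the factors from \<open>op_jacobian_eq\<close>.\<close>

lemma t_eq_op_jacobian:
  "t m n = op_jacobian (Dx \<circ> L1 \<circ> E1) (Dy \<circ> L2 \<circ> E2) ((inv E1 ^^ (m + 1)) ((inv E2 ^^ (n + 1)) (PQ m n)))"
  unfolding op_jacobian_eq t_eq_J inv_shift funpow_shift shift_shift
  by (simp add: algebra_simps)

end

section \<open>From indicators to the assumptions of \<open>delta_axis\<close>\<close>

lemma eventually_partial_sum:
  assumes "L f = (\<Sum>i\<le>k. scale2 (c i) ((d ^^ i) f))" "\<And>i. k < i \<Longrightarrow> (d ^^ i) f = 0"
  shows "\<forall>\<^sub>F N in sequentially. L f = (\<Sum>i\<le>N. scale2 (c i) ((d ^^ i) f))"
  using eventually_ge_at_top[of k]
proof eventually_elim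
  case (elim N)
  show ?case
    unfolding assms(1) by (rule sum.mono_neutral_left) (use elim assms(2) in \<open>auto simp: scale2_eq\<close>)
qed

lemma series_op_in_x:
  "series_op (fps_const a) f = (\<Sum>i\<le>total_degree f. scale2 (fps_nth a i) ((Dx ^^ i) f))"
proof -
  have "(\<Sum>j\<le>total_degree f. scale2 (fps_nth (fps_nth (fps_const a) j) i) ((Dx ^^ i) ((Dy ^^ j) f)))
      = (\<Sum>j\<le>total_degree f. if j = 0 then scale2 (fps_nth a i) ((Dx ^^ i) f) else 0)" for i
    by (rule sum.cong) (auto simp: scale2_eq)
  then show ?thesis
    by (simp add: series_op_def)
qed

lemma series_op_in_y:
  "series_op (Abs_fps (\<lambda>j. fps_const (fps_nth a j))) f
    = (\<Sum>j\<le>total_degree f. scale2 (fps_nth a j) ((Dy ^^ j) f))"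
proof -
  have "(\<Sum>i\<le>total_degree f. scale2 (fps_nth (fps_nth (Abs_fps (\<lambda>j. fps_const (fps_nth a j))) j) i)
        ((Dx ^^ i) ((Dy ^^ j) f)))
      = (\<Sum>i\<le>total_degree f. if i = 0 then scale2 (fps_nth a j) ((Dy ^^ j) f) else 0)" for j
    by (rule sum.cong) (auto simp: scale2_eq)
  then show ?thesis
    unfolding series_op_def by (subst sum.swap) simp
qed

lemma separable_pair_imp_separable_ops:
  assumes "separable_pair D1 D2 L1 L2"
  obtains c1 c2 where "separable_ops L1 L2 c1 c2"
proof -
  obtain a1 a2 where L: "linear2 L1" "bij L1" "linear2 L2" "bij L2"
    and L1: "L1 = series_op (fps_const a1)"
    and L2: "L2 = series_op (Abs_fps (\<lambda>j. fps_const (fps_nth a2 j)))"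
    using assms unfolding separable_pair_def shift_invariant_def has_indicator_def
      series_in_x_def series_in_y_def by blast
  have "delta_axis Dx L1 varX (fps_nth a1)"
  proof (rule delta_axis.intro)
    show "\<forall>\<^sub>F N in sequentially. L1 f = (\<Sum>i\<le>N. scale2 (fps_nth a1 i) ((Dx ^^ i) f))" for f
      unfolding L1 by (rule eventually_partial_sum[OF series_op_in_x funpow_Dx_eq_0])
  qed (use L in \<open>simp_all add: linear2_Dx Dx_mult\<close>)
  moreover have "delta_axis Dy L2 varY (fps_nth a2)"
  proof (rule delta_axis.intro)
    show "\<forall>\<^sub>F N in sequentially. L2 f = (\<Sum>i\<le>N. scale2 (fps_nth a2 i) ((Dy ^^ i) f))" for f
      unfolding L2 by (rule eventually_partial_sum[OF series_op_in_y funpow_Dy_eq_0])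
  qed (use L in \<open>simp_all add: linear2_Dy Dy_mult\<close>)
  ultimately show ?thesis
    using that by (simp add: separable_ops_def)
qed

text \<open>These are the denominators in (i); each has derivative 1 in its variable.\<close>

lemma var_minus_const2_nonzero: "varX - const2 r \<noteq> 0" "varY - const2 r \<noteq> 0"
proof -
  have "Dx (varX - const2 r) = 1" "Dy (varY - const2 r) = 1"
    by (simp_all add: linear2_diff linear2_Dx linear2_Dy)
  then show "varX - const2 r \<noteq> 0" "varY - const2 r \<noteq> 0"
    using linear2_0[OF linear2_Dx] linear2_0[OF linear2_Dy] by auto
qed

text \<open>Formula (i) is an identity in the fraction field because for \<open>m = 0\<close> or
  \<open>n = 0\<close> the corresponding quotient is not a polynomial.\<close>

theorem theorem6:
  fixes \<DD>\<^sub>x \<DD>\<^sub>y \<LL>\<^sub>x \<LL>\<^sub>y :: "real poly poly \<Rightarrow> real poly poly"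
    and A :: "real^2^2"
    and m n :: nat
  assumes "separable_pair \<DD>\<^sub>x \<DD>\<^sub>y \<LL>\<^sub>x \<LL>\<^sub>y"
  shows
    "(\<forall>p q.
        is_univariate_basic_sequence embed_x \<DD>\<^sub>x p \<longrightarrow>
        is_univariate_basic_sequence embed_y \<DD>\<^sub>y q \<longrightarrow>
        (let x = (\<lambda>i j. linear_grid A i j $ 1);
             y = (\<lambda>i j. linear_grid A i j $ 2)
         in to_fract (delta_abel \<DD>\<^sub>x \<DD>\<^sub>y A m n) =
              to_fract (det (vector
                [vector [varX - const2 (x 0 n), const2 (y m 0)],
                 vector [const2 (x 0 n), varY - const2 (y m 0)]] :: real poly poly^2^2))
              * (to_fract (embed_x (pcompose (p m) [:- x m n, 1:])) / to_fract (varX - const2 (x m n)))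
              * (to_fract (embed_y (pcompose (q n) [:- y m n, 1:])) / to_fract (varY - const2 (y m n)))))
     \<and>
     (let E1 = shift (A $ 1 $ 1) (A $ 2 $ 1);
          E2 = shift (A $ 1 $ 2) (A $ 2 $ 2);
          s1 = Dx \<circ> \<LL>\<^sub>x \<circ> E1;
          s2 = Dy \<circ> \<LL>\<^sub>y \<circ> E2
      in delta_abel \<DD>\<^sub>x \<DD>\<^sub>y A m n =
           (op_jacobian s1 s2 \<circ> (inv E1 ^^ (m + 1)) \<circ> (inv E2 ^^ (n + 1))
              \<circ> (inv \<LL>\<^sub>x ^^ (m + 1)) \<circ> (inv \<LL>\<^sub>y ^^ (n + 1))) (varX ^ m * varY ^ n))
     \<and>
     (let E1 = shift (A $ 1 $ 1) (A $ 2 $ 1);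
          E2 = shift (A $ 1 $ 2) (A $ 2 $ 2);
          T = op_det
                (\<lambda>f. pincherle_x \<DD>\<^sub>x f + scale2 (A $ 1 $ 1) (\<DD>\<^sub>x f))
                (\<lambda>f. scale2 (A $ 2 $ 1) (\<DD>\<^sub>x f))
                (\<lambda>f. scale2 (A $ 1 $ 2) (\<DD>\<^sub>y f))
                (\<lambda>f. pincherle_y \<DD>\<^sub>y f + scale2 (A $ 2 $ 2) (\<DD>\<^sub>y f))
              \<circ> (inv E1 ^^ m) \<circ> (inv E2 ^^ n)
              \<circ> (inv \<LL>\<^sub>x ^^ (m + 1)) \<circ> (inv \<LL>\<^sub>y ^^ (n + 1))
      in delta_abel \<DD>\<^sub>x \<DD>\<^sub>y A m n = T (varX ^ m * varY ^ n))"
proof -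
  obtain c1 c2 where "separable_ops \<LL>\<^sub>x \<LL>\<^sub>y c1 c2"
    by (rule separable_pair_imp_separable_ops[OF assms])
  then interpret separable_ops \<LL>\<^sub>x \<LL>\<^sub>y c1 c2 .
  interpret abel \<LL>\<^sub>x \<LL>\<^sub>y c1 c2 "A $ 1 $ 1" "A $ 1 $ 2" "A $ 2 $ 1" "A $ 2 $ 2" ..
  have D: "\<DD>\<^sub>x = X.D" "\<DD>\<^sub>y = Y.D"
    using assms by (simp_all add: separable_pair_def X.D_def Y.D_def)
  have grid: "linear_grid A = grid"
    by (intro ext) (simp add: linear_grid_def grid_def vec_eq_iff forall_2 matrix_vector_mult_def sum_2)
  have abel: "delta_abel \<DD>\<^sub>x \<DD>\<^sub>y A m n = t m n"
    by (simp add: delta_abel_def D grid goncarov_grid)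
  show ?thesis
  proof (intro conjI allI impI)
    fix p q
    assume "is_univariate_basic_sequence embed_x \<DD>\<^sub>x p" "is_univariate_basic_sequence embed_y \<DD>\<^sub>y q"
    then have pq: "embed_x (p m) = X.B m" "embed_y (q n) = Y.B n"
      by (simp_all add: D is_univariate_basic_sequence_x is_univariate_basic_sequence_y)
    \<comment> \<open>The free shift parameter of each embedding is chosen so that both factors
      carry the shift appearing in \<open>mult_t\<close>.\<close>
    have x: "embed_x (pcompose (p m) [:- (grid m n $ 1), 1:])
        = shift (- (grid m n $ 1)) (- (grid m n $ 2)) (X.B m)"
      and y: "embed_y (pcompose (q n) [:- (grid m n $ 2), 1:])
        = shift (- (grid m n $ 1)) (- (grid m n $ 2)) (Y.B n)"
      by (simp_all only: embed_x_pcompose[where b = "- (grid m n $ 2)"]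
          embed_y_pcompose[where a = "- (grid m n $ 1)"] pq)
    \<comment> \<open>Clearing denominators reduces (i) to the polynomial identity
      \<open>mult_t\<close>.\<close>
    have div: "t' = d * (p' / x') * (q' / y')"
      if "x' * y' * t' = d * (p' * q')" "x' \<noteq> 0" "y' \<noteq> 0" for t' d p' q' x' y' :: "bpoly fract"
      using that by (simp add: field_simps)
    show "let x = (\<lambda>i j. linear_grid A i j $ 1); y = (\<lambda>i j. linear_grid A i j $ 2)
       in to_fract (delta_abel \<DD>\<^sub>x \<DD>\<^sub>y A m n) =
            to_fract (det (vector
              [vector [varX - const2 (x 0 n), const2 (y m 0)],
               vector [const2 (x 0 n), varY - const2 (y m 0)]] :: real poly poly^2^2))
            * (to_fract (embed_x (pcompose (p m) [:- x m n, 1:])) / to_fract (varX - const2 (x m n)))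
            * (to_fract (embed_y (pcompose (q n) [:- y m n, 1:])) / to_fract (varY - const2 (y m n)))"
      unfolding Let_def grid abel x y
    proof (rule div)
      show "to_fract (varX - const2 (grid m n $ 1)) \<noteq> 0" "to_fract (varY - const2 (grid m n $ 2)) \<noteq> 0"
        by (simp_all only: to_fract_eq_0_iff var_minus_const2_nonzero not_False_eq_True)
    qed (simp only: mult_t det_2 vector_2 flip: to_fract_mult)
  next
    show "let E1 = shift (A $ 1 $ 1) (A $ 2 $ 1); E2 = shift (A $ 1 $ 2) (A $ 2 $ 2);
        s1 = Dx \<circ> \<LL>\<^sub>x \<circ> E1; s2 = Dy \<circ> \<LL>\<^sub>y \<circ> E2
      in delta_abel \<DD>\<^sub>x \<DD>\<^sub>y A m n =
           (op_jacobian s1 s2 \<circ> (inv E1 ^^ (m + 1)) \<circ> (inv E2 ^^ (n + 1))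
              \<circ> (inv \<LL>\<^sub>x ^^ (m + 1)) \<circ> (inv \<LL>\<^sub>y ^^ (n + 1))) (varX ^ m * varY ^ n)"
      unfolding Let_def abel comp_apply PQ_eq t_eq_op_jacobian comp_def ..
  next
    have "pincherle_x X.D = X.pin" "pincherle_y Y.D = Y.pin"
      by (simp_all add: fun_eq_iff pincherle_x_def pincherle_y_def X.pin_def Y.pin_def)
    then show "let E1 = shift (A $ 1 $ 1) (A $ 2 $ 1); E2 = shift (A $ 1 $ 2) (A $ 2 $ 2);
        T = op_det
              (\<lambda>f. pincherle_x \<DD>\<^sub>x f + scale2 (A $ 1 $ 1) (\<DD>\<^sub>x f))
              (\<lambda>f. scale2 (A $ 2 $ 1) (\<DD>\<^sub>x f))
              (\<lambda>f. scale2 (A $ 1 $ 2) (\<DD>\<^sub>y f))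
              (\<lambda>f. pincherle_y \<DD>\<^sub>y f + scale2 (A $ 2 $ 2) (\<DD>\<^sub>y f))
            \<circ> (inv E1 ^^ m) \<circ> (inv E2 ^^ n)
            \<circ> (inv \<LL>\<^sub>x ^^ (m + 1)) \<circ> (inv \<LL>\<^sub>y ^^ (n + 1))
      in delta_abel \<DD>\<^sub>x \<DD>\<^sub>y A m n = T (varX ^ m * varY ^ n)"
      unfolding Let_def D abel[unfolded D] comp_apply PQ_eq t_eq_J J_def by simp
  qed
qed

end
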